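(* Let $x_a\in\mathbb{R}$ be fixed, let $L:[a,b]\times\mathbb{R}^2\to\mathbb{R}$ be differentiable, $\phi:[a,b]\times\mathbb{R}\to\mathbb{R}$ of class $C^1$, $g:[a,b]\times\mathbb{R}^2\to\mathbb{R}$ of class $C^1$ and $\psi:[a,b]\to\mathbb{R}$ differentiable. Suppose that $(x,T)$ gives a local minimum on $D$ for the functional $$\mathcal{J}(x,T)=\int_a^TL[x]_\gamma^{\alpha,\beta}(t)\,dt+\phi(T,x(T))$$ subject to the boundary condition $x(a)=x_a$ and the isoperimetric constraint $$\int_a^Tg[x]_\gamma^{\alpha,\beta}(t)\,dt=\psi(T).$$ Then there exists $(\lambda_0,\lambda)\ne(0,0)$ such that, if we define $F:[a,b]\times\mathbb{R}^2\to\mathbb{R}$ by $F=\lambda_0L-\lambda g$, $(x,T)$ satisfies the fractional Euler--Lagrange equations $$\partial_2F[x]_\gamma^{\alpha,\beta}(t)+D_{\overline\gamma,T}^{\beta(\cdot,\cdot),\alpha(\cdot,\cdot)}\partial_3F[x]_\gamma^{\alpha,\beta}(t)=0$$ on the interval $[a,T]$, and $$\gamma_2\left({}_aD_t^{\beta(\cdot,\cdot)}\partial_3F[x]_\gamma^{\alpha,\beta}(t)-{}_TD_t^{\beta(\cdot,\cdot)}\partial_3F[x]_\gamma^{\alpha,\beta}(t)\right)=0$$ on the interval $[T,b]$.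
   Context: Let $a<b$ be reals, $\alpha,\beta:[a,b]^2\to(0,1)$ continuous functions, and $\gamma=(\gamma_1,\gamma_2)\in[0,1]^2$ with $\gamma_1,\gamma_2$ not both zero; $\overline\gamma=(\gamma_2,\gamma_1)$. For $c\in[a,b]$ and $\delta\in\{\alpha,\beta\}$ define the variable-order Riemann--Liouville integrals $${}_cI_t^{1-\delta(\cdot,\cdot)}f(t)=\int_c^t\frac{(t-\tau)^{-\delta(t,\tau)}}{\Gamma(1-\delta(t,\tau))}f(\tau)\,d\tau\ (t>c),\qquad {}_tI_c^{1-\delta(\cdot,\cdot)}f(t)=\int_t^c\frac{(\tau-t)^{-\delta(\tau,t)}}{\Gamma(1-\delta(\tau,t))}f(\tau)\,d\tau\ (t<c),$$ the Riemann--Liouville derivatives ${}_cD_t^{\delta(\cdot,\cdot)}f(t)=\frac{d}{dt}\,{}_cI_t^{1-\delta(\cdot,\cdot)}f(t)$ and ${}_tD_c^{\delta(\cdot,\cdot)}f(t)=-\frac{d}{dt}\,{}_tI_c^{1-\delta(\cdot,\cdot)}f(t)$, and the Caputo derivatives ${}_a^CD_t^{\alpha(\cdot,\cdot)}x(t)={}_aI_t^{1-\alpha(\cdot,\cdot)}x'(t)$ and ${}_t^CD_b^{\beta(\cdot,\cdot)}x(t)=-{}_tI_b^{1-\beta(\cdot,\cdot)}x'(t)$. The combined Caputo fractional derivative is ${}^CD_\gamma^{\alpha(\cdot,\cdot),\beta(\cdot,\cdot)}x(t)=\gamma_1\,{}_a^CD_t^{\alpha(\cdot,\cdot)}x(t)+\gamma_2\,{}_t^CD_b^{\beta(\cdot,\cdot)}x(t)$;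 for $c\in(a,b]$ the dual derivative is $D_{\overline\gamma,c}^{\beta(\cdot,\cdot),\alpha(\cdot,\cdot)}=\gamma_2\,{}_aD_t^{\beta(\cdot,\cdot)}+\gamma_1\,{}_tD_c^{\alpha(\cdot,\cdot)}$. Notation: $[x]_\gamma^{\alpha,\beta}(t)=\left(t,x(t),{}^CD_\gamma^{\alpha(\cdot,\cdot),\beta(\cdot,\cdot)}x(t)\right)$; $F[x]_\gamma^{\alpha,\beta}(t)$ means $F$ evaluated at this vector; $\partial_iF$ is the partial derivative with respect to the $i$th argument. $D=\{(x,t)\in C^1([a,b])\times[a,b]:\ {}^CD_\gamma^{\alpha(\cdot,\cdot),\beta(\cdot,\cdot)}x\in C([a,b])\}$, with norm $\|(x,t)\|=\max_{[a,b]}|x|+\max_{[a,b]}|{}^CD_\gamma^{\alpha(\cdot,\cdot),\beta(\cdot,\cdot)}x|+|t|$; local minimum is with respect to this norm among admissible pairs of $D$. $T$ and $x(T)$ are free.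
   Formalization: L is assumed differentiable with continuous ∂₂L and ∂₃L (false otherwise); as the separate Riemann–Liouville derivatives need not exist, the equations are proved for the derivative of the combined fractional integral, and literally wherever those derivatives exist. *)

theory Defs
  imports "HOL-Analysis.Analysis"
begin

text \<open>
  Variable orders and Lagrangians are functions on tuples: \<open>\<delta> (t, \<tau>)\<close>, \<open>L (t, x, v)\<close>.
  Functions on \<open>[a,b]\<close> are total functions of which only the values on \<open>{a..b}\<close> matter, so all
  derivatives at end points are taken within the interval.
\<close>

definition C1_on :: "('a::real_normed_vector \<Rightarrow> 'b::real_normed_vector) \<Rightarrow> 'a set \<Rightarrow> bool" where
  "C1_on f S \<longleftrightarrow>
     (\<exists>f'. (\<forall>p\<in>S. (f has_derivative blinfun_apply (f' p)) (at p within S)) \<and> continuous_on S f')"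

text \<open>At \<open>t = c\<close> (and on the wrong side of \<open>c\<close>) both integrals below are \<open>0\<close>.\<close>

definition RL_int_left :: "(real \<times> real \<Rightarrow> real) \<Rightarrow> real \<Rightarrow> (real \<Rightarrow> real) \<Rightarrow> real \<Rightarrow> real" where
  "RL_int_left \<delta> c f t =
     integral {c..t} (\<lambda>\<tau>. (t - \<tau>) powr (- \<delta> (t, \<tau>)) / Gamma (1 - \<delta> (t, \<tau>)) * f \<tau>)"

definition RL_int_right :: "(real \<times> real \<Rightarrow> real) \<Rightarrow> real \<Rightarrow> (real \<Rightarrow> real) \<Rightarrow> real \<Rightarrow> real" where
  "RL_int_right \<delta> c f t =
     integral {t..c} (\<lambda>\<tau>. (\<tau> - t) powr (- \<delta> (\<tau>, t)) / Gamma (1 - \<delta> (\<tau>, t)) * f \<tau>)"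

text \<open>
  The left derivative with base point \<open>c\<close> is the derivative of a function on \<open>(c,b]\<close>, the right one
  that of a function on \<open>[a,c)\<close>. The predicates \<open>has_RL_deriv_left\<close> and \<open>has_RL_deriv_right\<close> say
  that the derivative is defined at \<open>t\<close>; elsewhere the value of \<open>vector_derivative\<close> is unspecified.
\<close>

definition RL_deriv_left ::
  "(real \<times> real \<Rightarrow> real) \<Rightarrow> real \<Rightarrow> real \<Rightarrow> (real \<Rightarrow> real) \<Rightarrow> real \<Rightarrow> real" where
  "RL_deriv_left \<delta> b c f t = vector_derivative (RL_int_left \<delta> c f) (at t within {c..b})"

definition has_RL_deriv_left ::
  "(real \<times> real \<Rightarrow> real) \<Rightarrow> real \<Rightarrow> real \<Rightarrow> (real \<Rightarrow> real) \<Rightarrow> real \<Rightarrow> bool" where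
  "has_RL_deriv_left \<delta> b c f t \<longleftrightarrow>
     c < t \<and> t \<le> b \<and> RL_int_left \<delta> c f differentiable (at t within {c..b})"

definition RL_deriv_right ::
  "(real \<times> real \<Rightarrow> real) \<Rightarrow> real \<Rightarrow> real \<Rightarrow> (real \<Rightarrow> real) \<Rightarrow> real \<Rightarrow> real" where
  "RL_deriv_right \<delta> a c f t = - vector_derivative (RL_int_right \<delta> c f) (at t within {a..c})"

definition has_RL_deriv_right ::
  "(real \<times> real \<Rightarrow> real) \<Rightarrow> real \<Rightarrow> real \<Rightarrow> (real \<Rightarrow> real) \<Rightarrow> real \<Rightarrow> bool" where
  "has_RL_deriv_right \<delta> a c f t \<longleftrightarrow>
     a \<le> t \<and> t < c \<and> RL_int_right \<delta> c f differentiable (at t within {a..c})"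

definition caputo_left ::
  "(real \<times> real \<Rightarrow> real) \<Rightarrow> real \<Rightarrow> real \<Rightarrow> (real \<Rightarrow> real) \<Rightarrow> real \<Rightarrow> real" where
  "caputo_left \<alpha> a b x = RL_int_left \<alpha> a (\<lambda>\<tau>. vector_derivative x (at \<tau> within {a..b}))"

definition caputo_right ::
  "(real \<times> real \<Rightarrow> real) \<Rightarrow> real \<Rightarrow> real \<Rightarrow> (real \<Rightarrow> real) \<Rightarrow> real \<Rightarrow> real" where
  "caputo_right \<beta> a b x t =
     - RL_int_right \<beta> b (\<lambda>\<tau>. vector_derivative x (at \<tau> within {a..b})) t"

definition comb_caputo ::
  "real \<times> real \<Rightarrow> (real \<times> real \<Rightarrow> real) \<Rightarrow> (real \<times> real \<Rightarrow> real) \<Rightarrow> real \<Rightarrow> real \<Rightarrow>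
     (real \<Rightarrow> real) \<Rightarrow> real \<Rightarrow> real" where
  "comb_caputo \<gamma> \<alpha> \<beta> a b x t = fst \<gamma> * caputo_left \<alpha> a b x t + snd \<gamma> * caputo_right \<beta> a b x t"

text \<open>
  For \<open>\<gamma> = (\<gamma>\<^sub>1, \<gamma>\<^sub>2)\<close> this is the operator with weights \<open>(\<gamma>\<^sub>2, \<gamma>\<^sub>1)\<close> and orders \<open>\<beta>, \<alpha>\<close>.
\<close>

definition dual_deriv ::
  "real \<times> real \<Rightarrow> (real \<times> real \<Rightarrow> real) \<Rightarrow> (real \<times> real \<Rightarrow> real) \<Rightarrow> real \<Rightarrow> real \<Rightarrow> real \<Rightarrow>
     (real \<Rightarrow> real) \<Rightarrow> real \<Rightarrow> real" where
  "dual_deriv \<gamma> \<alpha> \<beta> a b c f t =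
     snd \<gamma> * RL_deriv_left \<beta> b a f t + fst \<gamma> * RL_deriv_right \<alpha> a c f t"

text \<open>
  The antiderivative of \<open>dual_deriv\<close>. It can be differentiable where its two terms are not, and
  then its derivative is the only meaning that \<open>dual_deriv\<close> can have.
\<close>

definition dual_int ::
  "real \<times> real \<Rightarrow> (real \<times> real \<Rightarrow> real) \<Rightarrow> (real \<times> real \<Rightarrow> real) \<Rightarrow> real \<Rightarrow> real \<Rightarrow>
     (real \<Rightarrow> real) \<Rightarrow> real \<Rightarrow> real" where
  "dual_int \<gamma> \<alpha> \<beta> a c f t = snd \<gamma> * RL_int_left \<beta> a f t - fst \<gamma> * RL_int_right \<alpha> c f t"

definition along ::
  "real \<times> real \<Rightarrow> (real \<times> real \<Rightarrow> real) \<Rightarrow> (real \<times> real \<Rightarrow> real) \<Rightarrow> real \<Rightarrow> real \<Rightarrow>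
     (real \<Rightarrow> real) \<Rightarrow> real \<Rightarrow> real \<times> real \<times> real" where
  "along \<gamma> \<alpha> \<beta> a b x t = (t, x t, comb_caputo \<gamma> \<alpha> \<beta> a b x t)"

definition partial2 :: "(real \<times> real \<times> real \<Rightarrow> real) \<Rightarrow> real \<times> real \<times> real \<Rightarrow> real" where
  "partial2 F = (\<lambda>(t, y, v). deriv (\<lambda>z. F (t, z, v)) y)"

definition partial3 :: "(real \<times> real \<times> real \<Rightarrow> real) \<Rightarrow> real \<times> real \<times> real \<Rightarrow> real" where
  "partial3 F = (\<lambda>(t, y, v). deriv (\<lambda>z. F (t, y, z)) v)"

definition D_space ::
  "real \<times> real \<Rightarrow> (real \<times> real \<Rightarrow> real) \<Rightarrow> (real \<times> real \<Rightarrow> real) \<Rightarrow> real \<Rightarrow> real \<Rightarrow>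
     ((real \<Rightarrow> real) \<times> real) set" where
  "D_space \<gamma> \<alpha> \<beta> a b =
     {(x, t). C1_on x {a..b} \<and> t \<in> {a..b} \<and> continuous_on {a..b} (comb_caputo \<gamma> \<alpha> \<beta> a b x)}"

definition D_norm ::
  "real \<times> real \<Rightarrow> (real \<times> real \<Rightarrow> real) \<Rightarrow> (real \<times> real \<Rightarrow> real) \<Rightarrow> real \<Rightarrow> real \<Rightarrow>
     (real \<Rightarrow> real) \<times> real \<Rightarrow> real" where
  "D_norm \<gamma> \<alpha> \<beta> a b = (\<lambda>(x, t).
     (SUP s\<in>{a..b}. \<bar>x s\<bar>) + (SUP s\<in>{a..b}. \<bar>comb_caputo \<gamma> \<alpha> \<beta> a b x s\<bar>) + \<bar>t\<bar>)"

definition local_min_on ::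
  "real \<times> real \<Rightarrow> (real \<times> real \<Rightarrow> real) \<Rightarrow> (real \<times> real \<Rightarrow> real) \<Rightarrow> real \<Rightarrow> real \<Rightarrow>
     ((real \<Rightarrow> real) \<Rightarrow> real \<Rightarrow> real) \<Rightarrow> ((real \<Rightarrow> real) \<times> real) set \<Rightarrow>
     (real \<Rightarrow> real) \<Rightarrow> real \<Rightarrow> bool" where
  "local_min_on \<gamma> \<alpha> \<beta> a b J A x T \<longleftrightarrow>
     (x, T) \<in> A \<and>
     (\<exists>\<epsilon>>0. \<forall>(y, S)\<in>A. D_norm \<gamma> \<alpha> \<beta> a b (\<lambda>s. y s - x s, S - T) < \<epsilon> \<longrightarrow> J x T \<le> J y S)"

end

theory Submission
  imports Defs
begin

text \<open>
  Keep \<open>T\<close> fixed and vary \<open>x\<close> along \<open>h\<close> with \<open>h a = h T = 0\<close>. On two-parameter variations the pair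
  (functional, constraint) is differentiable at \<open>0\<close>; at a minimum it cannot be an open map, so the
  first variations of \<open>L\<close> and \<open>g\<close> are proportional, which gives the multipliers. In the resulting
  identity \<open>\<integral>\<^sub>a\<^sup>T (\<partial>\<^sub>2F h + \<partial>\<^sub>3F D h) = 0\<close>, Fubini's theorem moves the weakly singular kernels of the Caputo
  derivative from \<open>h'\<close> to \<open>\<partial>\<^sub>3F\<close>. Since \<open>h'\<close> is arbitrary on \<open>[T,b]\<close> and has mean \<open>0\<close> on
  \<open>[a,T]\<close>, its coefficient vanishes on \<open>[T,b]\<close> and is constant on \<open>[a,T]\<close>.
\<close>

text \<open>Variations are parametrised by their derivative: a continuous \<open>w\<close> with
  integral 0 over [a,T], and \<open>h\<close> its primitive from \<open>a\<close>. The combined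
  Caputo derivative of \<open>h\<close> is then \<open>comb_RL_int\<close> of \<open>w\<close>,
  linear in \<open>w\<close> and continuous on [a,b], so every variation of \<open>x\<close> stays
  in \<open>D_space\<close>. One pair of multipliers has to serve all \<open>w\<close>; this is why
  proportionality is needed for arbitrary pairs \<open>w1\<close>, \<open>w2\<close>, hence the two
  parameters. The obstacle at the end is regularity. The partial derivative of \<open>F\<close> in
  its third argument is only continuous along \<open>x\<close>, so the left and the right
  Riemann-Liouville integral need not be differentiable separately. The du Bois-Reymond argument
  gives differentiability of just their combination \<open>dual_int\<close>, and of the difference
  of the two left integrals on [T,b]. The conclusion is therefore stated for these antiderivatives,
  and is split into separate derivatives wherever these exist.\<close>

section \<open>Integrals of a power of the distance to a point\<close>

lemma abs_diff_powr_integral: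
  fixes a b t q :: real
  assumes q: "q < 1" and t: "t \<in> {a..b}"
  shows "((\<lambda>s. \<bar>t - s\<bar> powr (- q)) has_integral
           ((t - a) powr (1 - q) + (b - t) powr (1 - q)) / (1 - q)) {a..b}"
proof -
  \<comment> \<open>The integrand may blow up at \<open>t\<close>, but its primitive is continuous
    there because 1 - q > 0. So the fundamental theorem is used on each side of \<open>t\<close>
    with differentiability only in the interior.\<close>
  have l: "((\<lambda>s. \<bar>t - s\<bar> powr (- q)) has_integral (- ((t - t) powr (1 - q) / (1 - q)) - - ((t - a) powr (1 - q) / (1 - q)))) {a..t}"
  proof (rule fundamental_theorem_of_calculus_interior)
    show "a \<le> t" using t by simp
    show "continuous_on {a..t} (\<lambda>s. - ((t - s) powr (1 - q) / (1 - q)))"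
      using q by (intro continuous_intros continuous_on_powr') auto
    show "((\<lambda>s. - ((t - s) powr (1 - q) / (1 - q))) has_vector_derivative \<bar>t - s\<bar> powr (- q)) (at s)"
      if "s \<in> {a<..<t}" for s
      unfolding has_real_derivative_iff_has_vector_derivative[symmetric]
      using that q by (auto intro!: derivative_eq_intros)
  qed
  have r: "((\<lambda>s. \<bar>t - s\<bar> powr (- q)) has_integral ((b - t) powr (1 - q) / (1 - q) - (t - t) powr (1 - q) / (1 - q))) {t..b}"
  proof (rule fundamental_theorem_of_calculus_interior)
    show "t \<le> b" using t by simp
    show "continuous_on {t..b} (\<lambda>s. (s - t) powr (1 - q) / (1 - q))"
      using q by (intro continuous_intros continuous_on_powr') auto
    show "((\<lambda>s. (s - t) powr (1 - q) / (1 - q)) has_vector_derivative \<bar>t - s\<bar> powr (- q)) (at s)"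
      if "s \<in> {t<..<b}" for s
      unfolding has_real_derivative_iff_has_vector_derivative[symmetric]
      using that q by (auto intro!: derivative_eq_intros)
  qed
  show ?thesis
    using has_integral_combine[OF _ _ l r] t q by (simp add: add_divide_distrib)
qed

text \<open>The bound is free of \<open>t\<close> and of the subinterval, which makes the later
  limits uniform in \<open>t\<close>. The factor 2 counts the two sides of \<open>t\<close>.\<close>

lemma abs_diff_powr_integral_le:
  fixes a b c d t q :: real
  assumes q: "q < 1" and t: "t \<in> {a..b}" and cd: "a \<le> c" "d \<le> b"
  shows "(\<lambda>s. \<bar>t - s\<bar> powr (- q)) integrable_on {c..d}"
    and "integral {c..d} (\<lambda>s. \<bar>t - s\<bar> powr (- q)) \<le> 2 * (b - a) powr (1 - q) / (1 - q)"
proof -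
  note I = abs_diff_powr_integral[OF q t]
  have ii: "(\<lambda>s. \<bar>t - s\<bar> powr (- q)) integrable_on {a..b}"
    using I by blast
  show 1: "(\<lambda>s. \<bar>t - s\<bar> powr (- q)) integrable_on {c..d}"
    by (rule integrable_on_subinterval[OF ii]) (use cd in auto)
  have "integral {c..d} (\<lambda>s. \<bar>t - s\<bar> powr (- q)) \<le> integral {a..b} (\<lambda>s. \<bar>t - s\<bar> powr (- q))"
    by (rule integral_subset_le[OF _ 1 ii]) (use cd in auto)
  also have "\<dots> = ((t - a) powr (1 - q) + (b - t) powr (1 - q)) / (1 - q)"
    using I by (rule integral_unique)
  also have "\<dots> \<le> ((b - a) powr (1 - q) + (b - a) powr (1 - q)) / (1 - q)"
    using q t by (intro divide_right_mono add_mono powr_mono2) auto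
  finally show "integral {c..d} (\<lambda>s. \<bar>t - s\<bar> powr (- q)) \<le> 2 * (b - a) powr (1 - q) / (1 - q)"
    by simp
qed

subsection \<open>Weakly singular kernels\<close>

text \<open>
  \<open>K\<close> is the limit of continuous kernels, up to a vanishing multiple of an integrable singularity
  on the diagonal. The condition is symmetric in the two variables, and it carries integrability,
  continuity of parameter integrals and Fubini's theorem over from the continuous kernels to \<open>K\<close>
  by uniform convergence, without measurability arguments in the plane.
\<close>

definition sing_approx ::
  "real \<Rightarrow> real \<Rightarrow> real \<Rightarrow> (real \<Rightarrow> real \<Rightarrow> real) \<Rightarrow> (nat \<Rightarrow> real \<Rightarrow> real \<Rightarrow> real) \<Rightarrow> (nat \<Rightarrow> real) \<Rightarrow> bool"
where
  "sing_approx a b q K k e \<longleftrightarrow> q < 1 \<and> e \<longlonglongrightarrow> 0 \<and> (\<forall>n. 0 \<le> e n) \<and>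
     (\<forall>n. continuous_on ({a..b} \<times> {a..b}) (\<lambda>(t, s). k n t s)) \<and>
     (\<forall>n. \<forall>t\<in>{a..b}. \<forall>s\<in>{a..b}. \<bar>K t s - k n t s\<bar> \<le> e n * \<bar>t - s\<bar> powr (- q))"

text \<open>Right integrals are left integrals with the kernel transposed, so this halves the work
  below.\<close>

lemma sing_approx_transpose:
  assumes "sing_approx a b q K k e"
  shows "sing_approx a b q (\<lambda>s t. K t s) (\<lambda>n s t. k n t s) e"
proof -
  have "continuous_on ({a..b} \<times> {a..b}) (\<lambda>(s, t). k n t s)" for n
  proof -
    have *: "(\<lambda>(s, t). k n t s) = (\<lambda>(t, s). k n t s) \<circ> prod.swap"
      by auto
    show ?thesis
      unfolding * using assms unfolding sing_approx_def
      by (intro continuous_on_compose continuous_on_swap) (auto simp: product_swap)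
  qed
  then show ?thesis
    using assms abs_minus_commute unfolding sing_approx_def by metis
qed

lemma sing_approx_section:
  assumes "sing_approx a b q K k e" "t \<in> {a..b}" "a \<le> c" "d \<le> b"
  shows "continuous_on {c..d} (k n t)"
proof -
  have *: "continuous_on ({a..b} \<times> {a..b}) (\<lambda>(t, s). k n t s)"
    using assms by (simp add: sing_approx_def)
  have "continuous_on {c..d} (\<lambda>s. (\<lambda>(t, s). k n t s) (t, s))"
    by (rule continuous_on_compose2[OF *]) (use assms in \<open>auto intro!: continuous_intros\<close>)
  then show ?thesis by simp
qed

text \<open>The integrand is squeezed between \<open>k n t s * v s\<close> plus and minus
  \<open>e n * B * \<bar>t - s\<bar> powr (- q)\<close>. The integrals of these two functions differ
  by at most \<open>e n * B * C * 2\<close>, which tends to 0.\<close>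

lemma sing_approx_integrable:
  assumes S: "sing_approx a b q K k e" and t: "t \<in> {a..b}" and cd: "a \<le> c" "d \<le> b"
    and v: "continuous_on {c..d} v"
  shows "(\<lambda>s. K t s * v s) integrable_on {c..d}"
proof (rule integrable_straddle)
  fix \<epsilon> :: real assume "0 < \<epsilon>"
  have q: "q < 1" using S by (simp add: sing_approx_def)
  define C where "C = 2 * (b - a) powr (1 - q) / (1 - q)"
  obtain B where B: "0 < B" "\<And>s. s \<in> {c..d} \<Longrightarrow> \<bar>v s\<bar> \<le> B"
  proof -
    have "bounded (v ` {c..d})"
      by (intro compact_imp_bounded compact_continuous_image v) simp
    then show ?thesis using that by (auto simp: bounded_pos)
  qed
  define I where "I = integral {c..d} (\<lambda>s. \<bar>t - s\<bar> powr (- q))"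
  have I: "((\<lambda>s. \<bar>t - s\<bar> powr (- q)) has_integral I) {c..d}" "I \<le> C" "0 \<le> I"
    using abs_diff_powr_integral_le[OF q t cd] unfolding I_def C_def
    by (auto intro: integral_nonneg)
  have "(\<lambda>n. e n * B * C * 2) \<longlonglongrightarrow> 0 * B * C * 2"
    using S by (intro tendsto_intros) (auto simp: sing_approx_def)
  then have "\<forall>\<^sub>F n in sequentially. e n * B * C * 2 < \<epsilon>"
    using order_tendstoD(2)[of _ 0 sequentially \<epsilon>] \<open>0 < \<epsilon>\<close> by auto
  then obtain n where n: "e n * B * C * 2 < \<epsilon>"
    by (auto simp: eventually_sequentially)
  have e: "0 \<le> e n" using S by (simp add: sing_approx_def)
  have "(\<lambda>s. k n t s * v s) integrable_on {c..d}"
    by (intro integrable_continuous_real continuous_intros v sing_approx_section[OF S t cd])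
  then obtain J where J: "((\<lambda>s. k n t s * v s) has_integral J) {c..d}" by blast
  define h where "h = (\<lambda>s. (e n * B) * \<bar>t - s\<bar> powr (- q))"
  have H: "(h has_integral (e n * B) * I) {c..d}"
    unfolding h_def by (rule has_integral_mult_right[OF I(1)])
  have bd: "\<bar>K t s * v s - k n t s * v s\<bar> \<le> h s" if s: "s \<in> {c..d}" for s
  proof -
    have "\<bar>K t s - k n t s\<bar> * \<bar>v s\<bar> \<le> (e n * \<bar>t - s\<bar> powr (- q)) * B"
      using S B s t cd e by (intro mult_mono) (auto simp: sing_approx_def)
    then show ?thesis
      by (simp add: h_def abs_mult[symmetric] algebra_simps)
  qed
  have "e n * B * I \<le> e n * B * C" using e B I by (intro mult_left_mono) auto
  moreover have "0 \<le> e n * B * I" using e B I by simp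
  ultimately have "\<bar>J - e n * B * I - (J + e n * B * I)\<bar> < \<epsilon>"
    using n by linarith
  then show "\<exists>g h i j. (g has_integral i) {c..d} \<and> (h has_integral j) {c..d} \<and> \<bar>i - j\<bar> < \<epsilon> \<and>
      (\<forall>x\<in>{c..d}. g x \<le> K t x * v x \<and> K t x * v x \<le> h x)"
    using has_integral_diff[OF J H] has_integral_add[OF J H] bd
    by (intro exI[of _ "\<lambda>s. k n t s * v s - h s"] exI[of _ "\<lambda>s. k n t s * v s + h s"] exI conjI ballI)
      (auto simp: abs_le_iff algebra_simps)
qed

lemma sing_approx_uniform_limit:
  assumes S: "sing_approx a b q K k e" and cd: "a \<le> c" "d \<le> b"
    and v: "continuous_on {c..d} v"
  shows "uniform_limit {a..b} (\<lambda>n t. integral {c..d} (\<lambda>s. k n t s * v s))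
           (\<lambda>t. integral {c..d} (\<lambda>s. K t s * v s)) sequentially"
proof -
  have q: "q < 1" using S by (simp add: sing_approx_def)
  define C where "C = 2 * (b - a) powr (1 - q) / (1 - q)"
  obtain B where B: "0 < B" "\<And>s. s \<in> {c..d} \<Longrightarrow> \<bar>v s\<bar> \<le> B"
  proof -
    have "bounded (v ` {c..d})"
      by (intro compact_imp_bounded compact_continuous_image v) simp
    then show ?thesis using that by (auto simp: bounded_pos)
  qed
  have bd: "\<bar>integral {c..d} (\<lambda>s. k n t s * v s) - integral {c..d} (\<lambda>s. K t s * v s)\<bar> \<le> e n * B * C"
    if t: "t \<in> {a..b}" for n t
  proof -
    have e: "0 \<le> e n" using S by (simp add: sing_approx_def)
    note I = abs_diff_powr_integral_le[OF q t cd]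
    have i1: "(\<lambda>s. k n t s * v s) integrable_on {c..d}"
      by (intro integrable_continuous_real continuous_intros v sing_approx_section[OF S t cd])
    have i2: "(\<lambda>s. K t s * v s) integrable_on {c..d}"
      by (rule sing_approx_integrable[OF S t cd v])
    have "norm (integral {c..d} (\<lambda>s. k n t s * v s - K t s * v s)) \<le> integral {c..d} (\<lambda>s. (e n * B) * \<bar>t - s\<bar> powr (- q))"
    proof (rule integral_norm_bound_integral)
      show "(\<lambda>s. k n t s * v s - K t s * v s) integrable_on {c..d}"
        using i1 i2 by (rule integrable_diff)
      show "(\<lambda>s. (e n * B) * \<bar>t - s\<bar> powr (- q)) integrable_on {c..d}"
        using I(1) by (rule integrable_on_mult_right)
      show "norm (k n t s * v s - K t s * v s) \<le> (e n * B) * \<bar>t - s\<bar> powr (- q)" if s: "s \<in> {c..d}" for s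
      proof -
        have "\<bar>K t s - k n t s\<bar> * \<bar>v s\<bar> \<le> (e n * \<bar>t - s\<bar> powr (- q)) * B"
          using S B s t cd e by (intro mult_mono) (auto simp: sing_approx_def)
        then show ?thesis
          by (simp add: abs_mult[symmetric] algebra_simps abs_minus_commute)
      qed
    qed
    also have "\<dots> \<le> e n * B * C"
      using I e B(1) mult_left_mono[of "integral {c..d} (\<lambda>s. \<bar>t - s\<bar> powr (- q))" C "e n * B"]
      unfolding C_def by simp
    finally show ?thesis using i1 i2 by (simp add: integral_diff)
  qed
  have "(\<lambda>n. e n * B * C) \<longlonglongrightarrow> 0 * B * C"
    using S by (intro tendsto_intros) (auto simp: sing_approx_def)
  then have lim: "(\<lambda>n. e n * B * C) \<longlonglongrightarrow> 0" by simp
  show ?thesis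
    unfolding uniform_limit_iff
  proof (intro allI impI)
    fix \<epsilon> :: real assume "0 < \<epsilon>"
    then have "\<forall>\<^sub>F n in sequentially. e n * B * C < \<epsilon>"
      using order_tendstoD(2)[OF lim] by auto
    then show "\<forall>\<^sub>F n in sequentially. \<forall>t\<in>{a..b}. dist (integral {c..d} (\<lambda>s. k n t s * v s)) (integral {c..d} (\<lambda>s. K t s * v s)) < \<epsilon>"
      by eventually_elim (auto simp: dist_real_def intro: le_less_trans[OF bd])
  qed
qed

lemma sing_approx_continuous_prod:
  assumes S: "sing_approx a b q K k e" and cd: "a \<le> c" "d \<le> b"
    and v: "continuous_on {c..d} v" 
  shows "continuous_on ({a..b} \<times> {c..d}) (\<lambda>(t, s). k n t s * v s)"
proof -
  have *: "continuous_on ({a..b} \<times> {a..b}) (\<lambda>(t, s). k n t s)"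
    using S by (simp add: sing_approx_def)
  show ?thesis unfolding case_prod_unfold
    by (intro continuous_intros continuous_on_subset[OF *[unfolded case_prod_unfold]]
          continuous_on_compose2[OF v]) (use cd in auto)
qed

lemma sing_approx_integral_continuous:
  assumes S: "sing_approx a b q K k e" and cd: "a \<le> c" "d \<le> b"
    and v: "continuous_on {c..d} v"
  shows "continuous_on {a..b} (\<lambda>t. integral {c..d} (\<lambda>s. K t s * v s))"
proof (rule uniform_limit_theorem[OF _ sing_approx_uniform_limit[OF S cd v]])
  have "continuous_on {a..b} (\<lambda>t. integral {c..d} (\<lambda>s. k n t s * v s))" for n
    using integral_continuous_on_param[of "{a..b}" c d "\<lambda>t s. k n t s * v s"]
      sing_approx_continuous_prod[OF S cd v, of n] by simp
  then show "\<forall>\<^sub>F n in sequentially. continuous_on {a..b} (\<lambda>t. integral {c..d} (\<lambda>s. k n t s * v s))"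
    by simp
qed simp

text \<open>The order is swapped for the continuous kernels, and both iterated integrals pass to the
  limit because the inner ones converge uniformly. The two end points differ in the application to
  the right Caputo derivative, where one variable stops at \<open>T\<close> and the other at
  \<open>b\<close>.\<close>

lemma sing_approx_Fubini:
  assumes S: "sing_approx a b q K k e" and T: "T \<le> b" "T' \<le> b"
    and u: "continuous_on {a..T} u" and v: "continuous_on {a..T'} v"
  shows "integral {a..T} (\<lambda>t. u t * integral {a..T'} (\<lambda>s. K t s * v s)) =
         integral {a..T'} (\<lambda>s. v s * integral {a..T} (\<lambda>t. K t s * u t))"
proof -
  \<comment> \<open>Stated for arbitrary kernels, end points and functions, since it is applied to
    \<open>K\<close> and, with all roles exchanged, to its transpose.\<close>
  have conv: "(\<lambda>n. integral {a..T} (\<lambda>t. u t * integral {a..T'} (\<lambda>s. k n t s * v s)))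
     \<longlonglongrightarrow> integral {a..T} (\<lambda>t. u t * integral {a..T'} (\<lambda>s. K t s * v s))"
    if S: "sing_approx a b q K k e" and T: "T \<le> b" "T' \<le> b"
    and u: "continuous_on {a..T} u" and v: "continuous_on {a..T'} v" for K k T T' u v
  proof -
    have *: "continuous_on {a..b} (\<lambda>t. integral {a..T'} (\<lambda>s. k n t s * v s))" for n
      using integral_continuous_on_param[of "{a..b}" a T' "\<lambda>t s. k n t s * v s"]
        sing_approx_continuous_prod[OF S order_refl T(2) v, of n] by simp
    have c: "continuous_on {a..T} (\<lambda>t. u t * integral {a..T'} (\<lambda>s. k n t s * v s))" for n
      using T by (auto intro!: continuous_intros u continuous_on_subset[OF *])
    have ul: "uniform_limit {a..T} (\<lambda>n t. u t * integral {a..T'} (\<lambda>s. k n t s * v s))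
      (\<lambda>t. u t * integral {a..T'} (\<lambda>s. K t s * v s)) sequentially"
    proof (rule uniform_lim_mult)
      show "uniform_limit {a..T} (\<lambda>n t. integral {a..T'} (\<lambda>s. k n t s * v s))
          (\<lambda>t. integral {a..T'} (\<lambda>s. K t s * v s)) sequentially"
        using T by (intro uniform_limit_on_subset[OF sing_approx_uniform_limit[OF S order_refl T(2) v]]) auto
      have "continuous_on {a..T} (\<lambda>t. integral {a..T'} (\<lambda>s. K t s * v s))"
        using T by (intro continuous_on_subset[OF sing_approx_integral_continuous[OF S order_refl T(2) v]]) auto
      then show "bounded ((\<lambda>t. integral {a..T'} (\<lambda>s. K t s * v s)) ` {a..T})"
        by (intro compact_imp_bounded compact_continuous_image) auto
      show "bounded (u ` {a..T})"
        using u by (intro compact_imp_bounded compact_continuous_image) auto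
    qed (rule uniform_limit_const)
    obtain I J where IJ: "\<And>n. ((\<lambda>t. u t * integral {a..T'} (\<lambda>s. k n t s * v s)) has_integral I n) {a..T}"
      "((\<lambda>t. u t * integral {a..T'} (\<lambda>s. K t s * v s)) has_integral J) {a..T}" "I \<longlonglongrightarrow> J"
      using uniform_limit_integral[OF ul c] by auto
    then show ?thesis
      by (simp add: integral_unique[OF IJ(1)] integral_unique[OF IJ(2)])
  qed
  have eq: "integral {a..T} (\<lambda>t. u t * integral {a..T'} (\<lambda>s. k n t s * v s)) =
     integral {a..T'} (\<lambda>s. v s * integral {a..T} (\<lambda>t. k n t s * u t))" for n
  proof -
    have 1: "continuous_on ({a..T} \<times> {a..T'}) (\<lambda>p. k n (fst p) (snd p) * v (snd p))"
      by (rule continuous_on_subset[OF sing_approx_continuous_prod[OF S order_refl T(2) v, unfolded case_prod_unfold]])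
        (use T in auto)
    have 2: "continuous_on ({a..T} \<times> {a..T'}) (\<lambda>p. u (fst p))"
      by (rule continuous_on_compose2[OF u]) (auto intro!: continuous_intros)
    have "continuous_on (cbox (a, a) (T, T')) (\<lambda>(t, s). u t * (k n t s * v s))"
      unfolding cbox_Pair_eq using continuous_on_mult[OF 2 1] by (simp add: case_prod_unfold)
    then have "integral (cbox a T) (\<lambda>t. integral (cbox a T') (\<lambda>s. u t * (k n t s * v s))) =
      integral (cbox a T') (\<lambda>s. integral (cbox a T) (\<lambda>t. u t * (k n t s * v s)))"
      by (rule integral_swap_continuous)
    moreover have "(\<lambda>s. integral (cbox a T) (\<lambda>t. u t * (k n t s * v s))) =
        (\<lambda>s. v s * integral (cbox a T) (\<lambda>t. k n t s * u t))"
      unfolding integral_mult_right[symmetric] by (simp add: mult_ac)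
    ultimately show ?thesis by simp
  qed
  show ?thesis
    using LIMSEQ_unique[OF conv[OF S T u v]]
      conv[OF sing_approx_transpose[OF S] T(2,1) v u] eq by simp
qed

subsection \<open>Variable-order Riemann--Liouville integrals\<close>

text \<open>The cut-off at \<open>s < t\<close> allows integration over an interval that does not
  depend on \<open>t\<close>. In both fractional integrals the order takes the later time first, so
  the right integral uses this same kernel with its arguments exchanged.\<close>

definition RL_kernel :: "(real \<times> real \<Rightarrow> real) \<Rightarrow> real \<Rightarrow> real \<Rightarrow> real" where
  "RL_kernel \<delta> t s = (if s < t then (t - s) powr (- \<delta> (t, s)) / Gamma (1 - \<delta> (t, s)) else 0)"

text \<open>On the compact square the order has a maximum \<open>p\<close> below 1. An exponent
  \<open>q\<close> strictly between \<open>p\<close> and 1 is still integrable, and the gap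
  \<open>q - p\<close> leaves a power of \<open>\<eta> n\<close> that tends to 0.\<close>

lemma RL_kernel_sing_approx:
  fixes \<delta> :: "real \<times> real \<Rightarrow> real"
  assumes ab: "a \<le> b" and c: "continuous_on ({a..b} \<times> {a..b}) \<delta>"
    and r: "\<And>p. p \<in> {a..b} \<times> {a..b} \<Longrightarrow> 0 < \<delta> p \<and> \<delta> p < 1"
  obtains q k e where "sing_approx a b q (RL_kernel \<delta>) k e"
proof -
  define Q where "Q = {a..b} \<times> {a..b}"
  have Q: "compact Q" "Q \<noteq> {}" using ab by (auto simp: Q_def compact_Times)
  obtain p0 where p0: "p0 \<in> Q" "\<And>p. p \<in> Q \<Longrightarrow> \<delta> p \<le> \<delta> p0"
    using continuous_attains_sup[OF Q] c unfolding Q_def by blast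
  define p where "p = \<delta> p0"
  define q where "q = (1 + p) / 2"
  have p: "0 < p" "p < 1" "p < q" "q < 1" using r p0 by (auto simp: p_def q_def Q_def)
  \<comment> \<open>The reciprocal Gamma function is entire, so neither poles nor zeros of
    \<open>Gamma\<close> need attention.\<close>
  have cG: "continuous_on Q (\<lambda>z. rGamma (1 - \<delta> z))"
    using c by (auto simp: Q_def intro!: continuous_intros continuous_on_compose2[OF continuous_on_rGamma[of UNIV]])
  obtain C where C: "0 < C" "\<And>z. z \<in> Q \<Longrightarrow> \<bar>rGamma (1 - \<delta> z)\<bar> \<le> C"
  proof -
    have "bounded ((\<lambda>z. rGamma (1 - \<delta> z)) ` Q)"
      by (intro compact_imp_bounded compact_continuous_image cG Q)
    then show ?thesis using that by (auto simp: bounded_pos)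
  qed
  \<comment> \<open>The bound \<open>\<eta> n \<le> 1\<close> matters: for \<sigma> below
    \<open>\<eta> n\<close> it gives
    \<open>\<sigma> powr (- d) \<le> \<sigma> powr (- p)\<close>.\<close>
  define \<eta> :: "nat \<Rightarrow> real" where "\<eta> n = 1 / (real n + 1)" for n
  have eta: "0 < \<eta> n" "\<eta> n \<le> 1" for n by (auto simp: \<eta>_def)
  \<comment> \<open>\<open>(t - s) powr (1 - \<delta>)\<close> extends continuously by \<open>0\<close> to \<open>s \<ge> t\<close>; dividing by \<open>max (t - s) (\<eta> n)\<close>
      changes the kernel only where \<open>t - s < \<eta> n\<close>, and there \<open>\<sigma> powr - p \<le> \<eta> n powr (q - p) * \<sigma> powr - q\<close>.\<close>
  define k where "k n t s = rGamma (1 - \<delta> (t, s)) * (max 0 (t - s)) powr (1 - \<delta> (t, s)) / max (t - s) (\<eta> n)"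
    for n and t s :: real
  define e where "e n = C * \<eta> n powr (q - p)" for n
  have "\<eta> \<longlonglongrightarrow> 0"
    unfolding \<eta>_def using LIMSEQ_inverse_real_of_nat by (simp add: inverse_eq_divide add.commute)
  then have "(\<lambda>n. C * \<eta> n powr (q - p)) \<longlonglongrightarrow> C * 0"
    using p eta by (intro tendsto_intros tendsto_zero_powrI[where b = "q - p"]) (auto simp: less_imp_le)
  then have e0: "e \<longlonglongrightarrow> 0" by (simp add: e_def[abs_def])
  have "sing_approx a b q (RL_kernel \<delta>) k e"
    unfolding sing_approx_def
  proof (intro conjI allI ballI)
    show "q < 1" "e \<longlonglongrightarrow> 0" by fact+
    show "0 \<le> e n" for n using C(1) by (simp add: e_def)
    show "continuous_on ({a..b} \<times> {a..b}) (\<lambda>(t, s). k n t s)" for n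
      unfolding k_def case_prod_unfold prod.collapse
      using c cG r eta[of n] unfolding Q_def
      by (intro continuous_intros continuous_on_powr') (fastforce simp: max_def)+
    fix n t s assume ts: "t \<in> {a..b}" "s \<in> {a..b}"
    define d where "d = \<delta> (t, s)"
    define R where "R = rGamma (1 - d)"
    have tsQ: "(t, s) \<in> Q" using ts by (simp add: Q_def)
    have d: "0 < d" "d < 1" "d \<le> p" using r p0(2) tsQ by (auto simp: d_def p_def Q_def)
    have R: "\<bar>R\<bar> \<le> C" using C(2)[OF tsQ] by (simp add: R_def d_def)
    show "\<bar>RL_kernel \<delta> t s - k n t s\<bar> \<le> e n * \<bar>t - s\<bar> powr (- q)"
    proof (cases "s < t")
      case False
      then show ?thesis using C(1) by (simp add: RL_kernel_def k_def e_def max_def)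
    next
      case True
      define \<sigma> where "\<sigma> = t - s"
      have \<sigma>: "0 < \<sigma>" using True by (simp add: \<sigma>_def)
      have K: "RL_kernel \<delta> t s = R * \<sigma> powr (- d)"
        using True by (simp add: RL_kernel_def \<sigma>_def R_def d_def rGamma_inverse_Gamma divide_inverse)
      have k: "k n t s = R * \<sigma> powr (1 - d) / max \<sigma> (\<eta> n)"
        using True by (simp add: k_def \<sigma>_def R_def d_def)
      have pd: "\<sigma> powr (1 - d) = \<sigma> * \<sigma> powr (- d)"
        using \<sigma> by (simp add: powr_diff powr_minus divide_inverse)
      show ?thesis
      proof (cases "\<eta> n \<le> \<sigma>")
        case True
        then have "k n t s = RL_kernel \<delta> t s" using \<sigma> by (simp add: K k pd max_def)
        then show ?thesis using C(1) by (simp add: e_def)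
      next
        case False
        then have lt: "\<sigma> < \<eta> n" by simp
        have "RL_kernel \<delta> t s - k n t s = R * \<sigma> powr (- d) * (1 - \<sigma> / \<eta> n)"
          using lt by (simp add: K k pd max_def algebra_simps)
        also have "\<bar>\<dots>\<bar> \<le> C * \<sigma> powr (- p) * 1"
        proof -
          have "\<sigma> powr (- d) \<le> \<sigma> powr (- p)"
            using \<sigma> lt eta[of n] d by (intro powr_mono') auto
          moreover have "\<bar>1 - \<sigma> / \<eta> n\<bar> \<le> 1" using \<sigma> lt eta[of n] by (simp add: field_simps)
          ultimately show ?thesis
            unfolding abs_mult using R C(1) by (intro mult_mono) auto
        qed
        also have "\<sigma> powr (- p) = \<sigma> powr (q - p) * \<sigma> powr (- q)"
          by (simp add: powr_add[symmetric])
        also have "C * (\<sigma> powr (q - p) * \<sigma> powr (- q)) * 1 \<le> C * (\<eta> n powr (q - p) * \<sigma> powr (- q)) * 1"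
          using \<sigma> lt p C(1) by (intro mult_right_mono mult_left_mono powr_mono2) auto
        finally show ?thesis using \<sigma> by (simp add: e_def \<sigma>_def mult.assoc)
      qed
    qed
  qed
  then show thesis by (rule that)
qed

lemma RL_int_left_kernel:
  assumes "c \<le> t" "t \<le> d"
  shows "RL_int_left \<delta> c f t = integral {c..d} (\<lambda>s. RL_kernel \<delta> t s * f s)"
proof -
  have "integral {c..d} (\<lambda>s. RL_kernel \<delta> t s * f s) = integral {c..d} (\<lambda>s. if s \<in> {c..t} then RL_kernel \<delta> t s * f s else 0)"
    by (rule integral_cong) (auto simp: RL_kernel_def)
  also have "\<dots> = integral {c..t} (\<lambda>s. RL_kernel \<delta> t s * f s)"
    using assms unfolding integral_restrict_Int by (simp add: Int_absorb1)
  also have "\<dots> = RL_int_left \<delta> c f t"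
    unfolding RL_int_left_def by (rule integral_cong) (auto simp: RL_kernel_def)
  finally show ?thesis by simp
qed

lemma RL_int_right_kernel:
  assumes "d \<le> t" "t \<le> c"
  shows "RL_int_right \<delta> c f t = integral {d..c} (\<lambda>s. RL_kernel \<delta> s t * f s)"
proof -
  have "integral {d..c} (\<lambda>s. RL_kernel \<delta> s t * f s) = integral {d..c} (\<lambda>s. if s \<in> {t..c} then RL_kernel \<delta> s t * f s else 0)"
    by (rule integral_cong) (auto simp: RL_kernel_def)
  also have "\<dots> = integral {t..c} (\<lambda>s. RL_kernel \<delta> s t * f s)"
    using assms unfolding integral_restrict_Int by (simp add: Int_absorb1)
  also have "\<dots> = RL_int_right \<delta> c f t"
    unfolding RL_int_right_def by (rule integral_cong) (auto simp: RL_kernel_def)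
  finally show ?thesis by simp
qed

lemma RL_int_left_continuous:
  assumes S: "sing_approx a b q (RL_kernel \<delta>) k e" and "a \<le> c" and f: "continuous_on {c..b} f"
  shows "continuous_on {c..b} (RL_int_left \<delta> c f)"
proof -
  have "continuous_on {c..b} (\<lambda>t. integral {c..b} (\<lambda>s. RL_kernel \<delta> t s * f s))"
    using assms by (intro continuous_on_subset[OF sing_approx_integral_continuous[OF S]]) auto
  then show ?thesis
    by (rule continuous_on_eq) (simp add: RL_int_left_kernel[of c _ b])
qed

lemma RL_int_right_continuous:
  assumes S: "sing_approx a b q (RL_kernel \<delta>) k e" and "c \<le> b" and f: "continuous_on {a..c} f"
  shows "continuous_on {a..c} (RL_int_right \<delta> c f)"
proof -
  have "continuous_on {a..c} (\<lambda>t. integral {a..c} (\<lambda>s. RL_kernel \<delta> s t * f s))"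
    using assms
    by (intro continuous_on_subset[OF sing_approx_integral_continuous[OF sing_approx_transpose[OF S]]]) auto
  then show ?thesis
    by (rule continuous_on_eq) (simp add: RL_int_right_kernel[of a _ c])
qed

lemma RL_int_left_linear:
  assumes S: "sing_approx a b q (RL_kernel \<delta>) k e" and t: "t \<in> {a..b}"
    and u: "continuous_on {a..b} u" and v: "continuous_on {a..b} v"
  shows "RL_int_left \<delta> a (\<lambda>s. A * u s + B * v s) t = A * RL_int_left \<delta> a u t + B * RL_int_left \<delta> a v t"
proof -
  have "(\<lambda>s. RL_kernel \<delta> t s * u s) integrable_on {a..b}" "(\<lambda>s. RL_kernel \<delta> t s * v s) integrable_on {a..b}"
    using sing_approx_integrable[OF S t order_refl order_refl] u v by auto
  note I = this[THEN integrable_on_mult_right]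
  have eq: "RL_kernel \<delta> t s * (A * u s + B * v s) = A * (RL_kernel \<delta> t s * u s) + B * (RL_kernel \<delta> t s * v s)" for s
    by (simp add: algebra_simps)
  show ?thesis
    using t by (simp add: RL_int_left_kernel[of a t b] eq integral_add[OF I] integral_mult_right)
qed

lemma RL_int_right_linear:
  assumes S: "sing_approx a b q (RL_kernel \<delta>) k e" and t: "t \<in> {a..b}"
    and u: "continuous_on {a..b} u" and v: "continuous_on {a..b} v"
  shows "RL_int_right \<delta> b (\<lambda>s. A * u s + B * v s) t = A * RL_int_right \<delta> b u t + B * RL_int_right \<delta> b v t"
proof -
  have "(\<lambda>s. RL_kernel \<delta> s t * u s) integrable_on {a..b}" "(\<lambda>s. RL_kernel \<delta> s t * v s) integrable_on {a..b}"
    using sing_approx_integrable[OF sing_approx_transpose[OF S] t order_refl order_refl] u v by auto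
  note I = this[THEN integrable_on_mult_right]
  have eq: "RL_kernel \<delta> s t * (A * u s + B * v s) = A * (RL_kernel \<delta> s t * u s) + B * (RL_kernel \<delta> s t * v s)" for s
    by (simp add: algebra_simps)
  show ?thesis
    using t by (simp add: RL_int_right_kernel[of a t b] eq integral_add[OF I] integral_mult_right)
qed

text \<open>The double integral runs over the triangle s < t inside the square over [a,T], so
  nothing beyond \<open>T\<close> enters.\<close>

lemma RL_int_Fubini_left:
  assumes S: "sing_approx a b q (RL_kernel \<delta>) k e" and T: "T \<le> b"
    and f: "continuous_on {a..T} f" and w: "continuous_on {a..T} w"
  shows "integral {a..T} (\<lambda>t. f t * RL_int_left \<delta> a w t) = integral {a..T} (\<lambda>s. w s * RL_int_right \<delta> T f s)"
proof -
  have "integral {a..T} (\<lambda>t. f t * RL_int_left \<delta> a w t) =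
      integral {a..T} (\<lambda>t. f t * integral {a..T} (\<lambda>s. RL_kernel \<delta> t s * w s))"
    by (rule integral_cong) (simp add: RL_int_left_kernel[of a _ T])
  also have "\<dots> = integral {a..T} (\<lambda>s. w s * integral {a..T} (\<lambda>t. RL_kernel \<delta> t s * f t))"
    by (rule sing_approx_Fubini[OF S T T f w])
  also have "\<dots> = integral {a..T} (\<lambda>s. w s * RL_int_right \<delta> T f s)"
    by (rule integral_cong) (simp add: RL_int_right_kernel[of a _ T])
  finally show ?thesis .
qed

text \<open>
  The right integral reaches up to \<open>b\<close> while \<open>t\<close> stops at \<open>T\<close>; this is where the condition on \<open>[T,b]\<close>
  comes from.
\<close>

lemma RL_int_Fubini_right:
  assumes S: "sing_approx a b q (RL_kernel \<delta>) k e" and T: "a \<le> T" "T \<le> b"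
    and f: "continuous_on {a..b} f" and w: "continuous_on {a..b} w"
  shows "integral {a..T} (\<lambda>t. f t * RL_int_right \<delta> b w t) =
    integral {a..T} (\<lambda>s. w s * RL_int_left \<delta> a f s) +
    integral {T..b} (\<lambda>s. w s * (RL_int_left \<delta> a f s - RL_int_left \<delta> T f s))"
proof -
  note S' = sing_approx_transpose[OF S]
  have fT: "continuous_on {a..T} f" using f T by (rule_tac continuous_on_subset) auto
  have fT': "continuous_on {T..b} f" using f T by (rule_tac continuous_on_subset) auto
  have "integral {a..T} (\<lambda>t. f t * RL_int_right \<delta> b w t) =
      integral {a..T} (\<lambda>t. f t * integral {a..b} (\<lambda>s. RL_kernel \<delta> s t * w s))"
    using T by (intro integral_cong) (simp add: RL_int_right_kernel[of a _ b])
  also have "\<dots> = integral {a..b} (\<lambda>s. w s * integral {a..T} (\<lambda>t. RL_kernel \<delta> s t * f t))"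
    by (rule sing_approx_Fubini[OF S' T(2) order_refl fT w])
  also have "\<dots> = integral {a..T} (\<lambda>s. w s * integral {a..T} (\<lambda>t. RL_kernel \<delta> s t * f t)) +
      integral {T..b} (\<lambda>s. w s * integral {a..T} (\<lambda>t. RL_kernel \<delta> s t * f t))"
    by (intro Henstock_Kurzweil_Integration.integral_combine[symmetric] T integrable_continuous_real
        continuous_intros w sing_approx_integral_continuous[OF S order_refl T(2) fT])
  also have "integral {a..T} (\<lambda>s. w s * integral {a..T} (\<lambda>t. RL_kernel \<delta> s t * f t)) =
      integral {a..T} (\<lambda>s. w s * RL_int_left \<delta> a f s)"
    by (intro integral_cong) (simp add: RL_int_left_kernel[of a _ T])
  also have "integral {T..b} (\<lambda>s. w s * integral {a..T} (\<lambda>t. RL_kernel \<delta> s t * f t)) =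
      integral {T..b} (\<lambda>s. w s * (RL_int_left \<delta> a f s - RL_int_left \<delta> T f s))"
  proof (rule integral_cong)
    fix s assume s: "s \<in> {T..b}"
    \<comment> \<open>Since \<open>s\<close> lies beyond \<open>T\<close>, the integral over [a,T]
      is not itself a fractional integral at \<open>s\<close>; it is the difference of those with
      base points \<open>a\<close> and \<open>T\<close>.\<close>
    then have "(\<lambda>t. RL_kernel \<delta> s t * f t) integrable_on {a..b}"
      using T by (intro sing_approx_integrable[OF S] f) auto
    then have "integral {a..T} (\<lambda>t. RL_kernel \<delta> s t * f t) + integral {T..b} (\<lambda>t. RL_kernel \<delta> s t * f t) =
        integral {a..b} (\<lambda>t. RL_kernel \<delta> s t * f t)"
      by (intro Henstock_Kurzweil_Integration.integral_combine T)
    then show "w s * integral {a..T} (\<lambda>t. RL_kernel \<delta> s t * f t) = w s * (RL_int_left \<delta> a f s - RL_int_left \<delta> T f s)"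
      using s T by (simp add: RL_int_left_kernel[of _ s b])
  qed
  finally show ?thesis .
qed

subsection \<open>First variation\<close>

text \<open>\<open>G\<close> is differentiable only within the strip, hence one-sidedly in time at
  the end points. Freezing \<open>t\<close> leaves a function on the whole plane and a two-sided
  derivative, as \<open>deriv\<close> in the partial derivatives requires.\<close>

lemma slice_has_derivative:
  assumes G: "(G has_derivative G') (at (t, y, v) within {a..b} \<times> UNIV \<times> UNIV)" and t: "t \<in> {a..b::real}"
  shows "((\<lambda>z. G (t, z)) has_derivative (\<lambda>z. G' (0, z))) (at (y, v))"
proof -
  have "((\<lambda>z. (t, z)) has_derivative (\<lambda>z. (0, z))) (at (y, v))"
    by (auto intro!: derivative_eq_intros)
  moreover have "(G has_derivative G') (at (t, y, v) within range (\<lambda>z. (t, z)))"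
    using t by (intro has_derivative_subset[OF G]) auto
  ultimately show ?thesis
    using has_derivative_in_compose[of "\<lambda>z. (t, z)" _ "(y, v)" UNIV G G'] by simp
qed

lemma partials_of_derivative:
  fixes G :: "real \<times> real \<times> real \<Rightarrow> real"
  assumes G: "(G has_derivative G') (at (t, y, v) within {a..b} \<times> UNIV \<times> UNIV)" and t: "t \<in> {a..b}"
  shows "((\<lambda>z. G (t, z, v)) has_real_derivative G' (0, 1, 0)) (at y)"
    and "((\<lambda>z. G (t, y, z)) has_real_derivative G' (0, 0, 1)) (at v)"
    and "partial2 G (t, y, v) = G' (0, 1, 0)" and "partial3 G (t, y, v) = G' (0, 0, 1)"
    and "G' (0, dy, dv) = partial2 G (t, y, v) * dy + partial3 G (t, y, v) * dv"
proof -
  interpret G': bounded_linear G' using G by (rule has_derivative_bounded_linear)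
  note D = slice_has_derivative[OF G t]
  have l2: "G' (0, dy, 0) = dy * G' (0, 1, 0)" for dy
    using G'.scaleR[of dy "(0, 1, 0)"] by simp
  have l3: "G' (0, 0, dv) = dv * G' (0, 0, 1)" for dv
    using G'.scaleR[of dv "(0, 0, 1)"] by simp
  have lin: "G' (0, dy, dv) = dy * G' (0, 1, 0) + dv * G' (0, 0, 1)"
    using G'.add[of "(0, dy, 0)" "(0, 0, dv)"] unfolding l2[symmetric] l3[symmetric] by simp
  have "((\<lambda>z. (z, v)) has_derivative (\<lambda>z. (z, 0))) (at y)"
    by (auto intro!: derivative_eq_intros)
  from has_derivative_compose[OF this D] show d2: "((\<lambda>z. G (t, z, v)) has_real_derivative G' (0, 1, 0)) (at y)"
    by (rule has_derivative_imp_has_field_derivative) (rule l2[symmetric])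
  have "((\<lambda>z. (y, z)) has_derivative (\<lambda>z. (0, z))) (at v)"
    by (auto intro!: derivative_eq_intros)
  from has_derivative_compose[OF this D] show d3: "((\<lambda>z. G (t, y, z)) has_real_derivative G' (0, 0, 1)) (at v)"
    by (rule has_derivative_imp_has_field_derivative) (rule l3[symmetric])
  show p: "partial2 G (t, y, v) = G' (0, 1, 0)" "partial3 G (t, y, v) = G' (0, 0, 1)"
    using d2 d3 by (auto simp: partial2_def partial3_def intro: DERIV_imp_deriv)
  show "G' (0, dy, dv) = partial2 G (t, y, v) * dy + partial3 G (t, y, v) * dv"
    using lin p by simp
qed

lemma partial_diff_scaled:
  fixes L g :: "real \<times> real \<times> real \<Rightarrow> real"
  assumes "L differentiable_on {a..b} \<times> UNIV \<times> UNIV" "g differentiable_on {a..b} \<times> UNIV \<times> UNIV"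
    and t: "t \<in> {a..b}"
  shows "partial2 (\<lambda>p. c * L p - d * g p) (t, y, v) = c * partial2 L (t, y, v) - d * partial2 g (t, y, v)"
    and "partial3 (\<lambda>p. c * L p - d * g p) (t, y, v) = c * partial3 L (t, y, v) - d * partial3 g (t, y, v)"
proof -
  obtain L' g' where L': "(L has_derivative L') (at (t, y, v) within {a..b} \<times> UNIV \<times> UNIV)"
    and g': "(g has_derivative g') (at (t, y, v) within {a..b} \<times> UNIV \<times> UNIV)"
    using assms unfolding differentiable_on_def differentiable_def by (metis UNIV_I mem_Sigma_iff)
  have F: "((\<lambda>p. c * L p - d * g p) has_derivative (\<lambda>p. c * L' p - d * g' p)) (at (t, y, v) within {a..b} \<times> UNIV \<times> UNIV)"
    by (intro derivative_intros L' g')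
  note P = partials_of_derivative[OF _ t]
  show "partial2 (\<lambda>p. c * L p - d * g p) (t, y, v) = c * partial2 L (t, y, v) - d * partial2 g (t, y, v)"
    "partial3 (\<lambda>p. c * L p - d * g p) (t, y, v) = c * partial3 L (t, y, v) - d * partial3 g (t, y, v)"
    using P(3,4)[OF F] P(3,4)[OF L'] P(3,4)[OF g'] by simp_all
qed

text \<open>The partial derivatives are values of the total derivative at basis vectors, so they
  inherit its continuity. This gives \<open>g\<close> the properties that are assumed of
  \<open>L\<close>.\<close>

lemma C1_on_partials:
  fixes g :: "real \<times> real \<times> real \<Rightarrow> real"
  assumes "C1_on g ({a..b} \<times> UNIV \<times> UNIV)"
  shows "g differentiable_on {a..b} \<times> UNIV \<times> UNIV"
    and "continuous_on ({a..b} \<times> UNIV \<times> UNIV) (partial2 g)"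
    and "continuous_on ({a..b} \<times> UNIV \<times> UNIV) (partial3 g)"
proof -
  let ?S = "{a..b} \<times> UNIV \<times> UNIV :: (real \<times> real \<times> real) set"
  obtain g' where g': "\<And>p. p \<in> ?S \<Longrightarrow> (g has_derivative blinfun_apply (g' p)) (at p within ?S)"
    and c: "continuous_on ?S g'"
    using assms unfolding C1_on_def by blast
  show "g differentiable_on ?S"
    using g' unfolding differentiable_on_def differentiable_def by blast
  have p: "g' p (0, 1, 0) = partial2 g p" "g' p (0, 0, 1) = partial3 g p" if "p \<in> ?S" for p
    using partials_of_derivative(3,4)[of g "g' p" "fst p" "fst (snd p)" "snd (snd p)" a b] g'[OF that] that
    by auto
  have "continuous_on ?S (\<lambda>p. g' p (0, 1, 0))" by (intro continuous_intros c)
  then show "continuous_on ?S (partial2 g)" by (rule continuous_on_eq) (rule p)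
  have "continuous_on ?S (\<lambda>p. g' p (0, 0, 1))" by (intro continuous_intros c)
  then show "continuous_on ?S (partial3 g)" by (rule continuous_on_eq) (rule p)
qed

text \<open>Differentiation under the integral sign: for fixed \<open>t\<close> the chain rule
  applies to the slice of \<open>G\<close>, and the resulting derivative is jointly continuous
  because both partial derivatives are.\<close>

lemma first_variation:
  fixes G :: "real \<times> real \<times> real \<Rightarrow> real" and y v h1 h2 c1 c2 :: "real \<Rightarrow> real"
  assumes G: "G differentiable_on {a..b} \<times> UNIV \<times> UNIV"
    and G2: "continuous_on ({a..b} \<times> UNIV \<times> UNIV) (partial2 G)"
    and G3: "continuous_on ({a..b} \<times> UNIV \<times> UNIV) (partial3 G)"
    and T: "T \<le> b"
    and c: "continuous_on {a..T} y" "continuous_on {a..T} v"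
      "continuous_on {a..T} h1" "continuous_on {a..T} c1" "continuous_on {a..T} h2" "continuous_on {a..T} c2"
  defines "\<Phi> \<equiv> (\<lambda>e :: real \<times> real. integral {a..T}
      (\<lambda>t. G (t, y t + (fst e * h1 t + snd e * h2 t), v t + (fst e * c1 t + snd e * c2 t))))"
    and "A1 \<equiv> integral {a..T} (\<lambda>t. partial2 G (t, y t, v t) * h1 t + partial3 G (t, y t, v t) * c1 t)"
    and "A2 \<equiv> integral {a..T} (\<lambda>t. partial2 G (t, y t, v t) * h2 t + partial3 G (t, y t, v t) * c2 t)"
  shows "(\<Phi> has_derivative (\<lambda>e. fst e * A1 + snd e * A2)) (at 0)"
    and "continuous_on UNIV \<Phi>"
proof -
  define P where "P e t = (t, y t + (fst e * h1 t + snd e * h2 t), v t + (fst e * c1 t + snd e * c2 t))"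
    for e :: "real \<times> real" and t
  define B1 where "B1 e t = partial2 G (P e t) * h1 t + partial3 G (P e t) * c1 t" for e t
  define B2 where "B2 e t = partial2 G (P e t) * h2 t + partial3 G (P e t) * c2 t" for e t
  let ?S = "{a..b} \<times> UNIV \<times> UNIV :: (real \<times> real \<times> real) set"
  \<comment> \<open>\<open>leibniz_rule\<close> takes the derivative as a bounded linear map; here
    it is a combination of the two coordinate projections of the parameter plane.\<close>
  define GP where "GP e t = B1 e t *\<^sub>R (fst_blinfun :: (real \<times> real) \<Rightarrow>\<^sub>L real) + B2 e t *\<^sub>R snd_blinfun" for e t
  have cc: "continuous_on (UNIV \<times> {a..T}) (\<lambda>p. f (snd p))" if "continuous_on {a..T} f"
    for f :: "real \<Rightarrow> real"
    by (rule continuous_on_compose2[OF that]) (auto intro!: continuous_intros)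
  have cP: "continuous_on (UNIV \<times> {a..T}) (\<lambda>p. P (fst p) (snd p))"
    unfolding P_def by (intro continuous_intros cc c)
  have PS: "(\<lambda>p. P (fst p) (snd p)) ` (UNIV \<times> {a..T}) \<subseteq> ?S"
    using T by (auto simp: P_def)
  have cB: "continuous_on (UNIV \<times> {a..T}) (\<lambda>p. B1 (fst p) (snd p))"
    "continuous_on (UNIV \<times> {a..T}) (\<lambda>p. B2 (fst p) (snd p))"
    unfolding B1_def B2_def
    by (intro continuous_intros cc c continuous_on_compose2[OF G2 cP PS] continuous_on_compose2[OF G3 cP PS])+
  have cG: "continuous_on ?S G"
    using G by (rule differentiable_imp_continuous_on)
  have cGP: "continuous_on (UNIV \<times> {a..T}) (\<lambda>(e, t). G (P e t))"
    unfolding case_prod_unfold by (rule continuous_on_compose2[OF cG cP PS])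
  have sec: "(\<lambda>t. F e t) integrable_on {a..T}" if "continuous_on (UNIV \<times> {a..T}) (\<lambda>p. F (fst p) (snd p))"
    for F :: "real \<times> real \<Rightarrow> real \<Rightarrow> real" and e
  proof (rule integrable_continuous_real)
    have "continuous_on {a..T} (\<lambda>t. F (fst (e, t)) (snd (e, t)))"
      by (rule continuous_on_compose2[OF that]) (auto intro!: continuous_intros)
    then show "continuous_on {a..T} (\<lambda>t. F e t)" by simp
  qed
  have int: "(\<lambda>t. G (P e t)) integrable_on {a..T}" for e
    using sec[of "\<lambda>e t. G (P e t)"] cGP by (simp add: case_prod_unfold)
  have Bint: "(\<lambda>t. B1 e t) integrable_on {a..T}" "(\<lambda>t. B2 e t) integrable_on {a..T}" for e
    using sec[OF cB(1)] sec[OF cB(2)] by auto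
  have \<Phi>: "\<Phi> = (\<lambda>e. integral (cbox a T) (\<lambda>t. G (P e t)))"
    by (simp add: \<Phi>_def P_def)
  have "((\<lambda>e. integral (cbox a T) (\<lambda>t. G (P e t))) has_derivative integral (cbox a T) (GP 0)) (at 0 within UNIV)"
  proof (rule leibniz_rule)
    show "((\<lambda>e. G (P e t)) has_derivative GP e t) (at e within UNIV)" if "t \<in> cbox a T" for e t
    proof -
      have t: "t \<in> {a..b}" using that T by auto
      define p where "p = snd (P e t)"
      have Pp: "P e t = (t, fst p, snd p)" by (simp add: p_def P_def)
      obtain G' where G': "(G has_derivative G') (at (t, fst p, snd p) within ?S)"
        using G t unfolding differentiable_on_def differentiable_def by (metis UNIV_I mem_Sigma_iff)
      have D: "((\<lambda>z. G (t, z)) has_derivative (\<lambda>z. G' (0, z))) (at (snd (P e t)))"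
        using slice_has_derivative[OF G' t] by (simp add: p_def)
      have "((\<lambda>e. snd (P e t)) has_derivative (\<lambda>d. (fst d * h1 t + snd d * h2 t, fst d * c1 t + snd d * c2 t))) (at e)"
        unfolding P_def by (auto intro!: derivative_eq_intros)
      from has_derivative_compose[OF this D]
      have "((\<lambda>e. G (P e t)) has_derivative
          (\<lambda>d. G' (0, fst d * h1 t + snd d * h2 t, fst d * c1 t + snd d * c2 t))) (at e)"
        by (simp add: P_def)
      moreover have "(\<lambda>d. G' (0, fst d * h1 t + snd d * h2 t, fst d * c1 t + snd d * c2 t)) = GP e t"
        unfolding partials_of_derivative(5)[OF G' t]
        by (auto simp: GP_def B1_def B2_def Pp plus_blinfun.rep_eq scaleR_blinfun.rep_eq algebra_simps)
      ultimately show ?thesis by simp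
    qed
    show "(\<lambda>t. G (P e t)) integrable_on cbox a T" for e using int by simp
    show "continuous_on (UNIV \<times> cbox a T) (\<lambda>(e, t). GP e t)"
      using cB unfolding GP_def case_prod_unfold by (auto intro!: continuous_intros)
  qed auto
  moreover have "integral (cbox a T) (GP 0) = A1 *\<^sub>R fst_blinfun + A2 *\<^sub>R snd_blinfun"
  proof (rule integral_unique)
    have "(B1 0 has_integral A1) (cbox a T)" "(B2 0 has_integral A2) (cbox a T)"
      using Bint[of 0] unfolding A1_def A2_def B1_def B2_def P_def by (auto intro: integrable_integral)
    then show "(GP 0 has_integral A1 *\<^sub>R fst_blinfun + A2 *\<^sub>R snd_blinfun) (cbox a T)"
      unfolding GP_def by (intro has_integral_add has_integral_scaleR_left)
  qed
  ultimately show "(\<Phi> has_derivative (\<lambda>e. fst e * A1 + snd e * A2)) (at 0)"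
    unfolding \<Phi> by (simp add: plus_blinfun.rep_eq scaleR_blinfun.rep_eq mult.commute cong: if_cong)
  show "continuous_on UNIV \<Phi>"
    unfolding \<Phi> by (rule integral_continuous_on_param) (use cGP in simp)
qed

subsection \<open>Multiplier rule and du Bois-Reymond lemma\<close>

text \<open>Any \<open>v\<close> with \<open>B v \<noteq> 0\<close> gives the multipliers
  \<open>B v\<close> and \<open>A v\<close>. If \<open>B\<close> vanishes on \<open>W\<close>, the
  constraint is degenerate to first order and the abnormal pair 0, 1 works.\<close>

lemma lagrange_multiplier_of_proportional:
  fixes A B :: "'w \<Rightarrow> real"
  assumes "\<And>u v. u \<in> W \<Longrightarrow> v \<in> W \<Longrightarrow> A u * B v = A v * B u"
  obtains l0 l where "(l0, l) \<noteq> (0, 0)" "\<And>w. w \<in> W \<Longrightarrow> l0 * A w - l * B w = 0"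
proof (cases "\<exists>v\<in>W. B v \<noteq> 0")
  case True
  then obtain v where "v \<in> W" "B v \<noteq> 0" by blast
  with assms show ?thesis by (intro that[of "B v" "A v"]) (auto simp: mult.commute)
next
  case False
  then show ?thesis by (intro that[of 0 1]) auto
qed

text \<open>
  If the determinant did not vanish, \<open>(\<Phi>, \<Psi>)\<close> would be open at \<open>0\<close>, so \<open>\<Phi>\<close> could be lowered while
  keeping \<open>\<Psi>\<close> fixed. Differentiability at the single point \<open>0\<close> suffices for this.
\<close>

lemma constrained_min_det_eq_0:
  fixes \<Phi> \<Psi> :: "real \<times> real \<Rightarrow> real"
  assumes \<Phi>: "(\<Phi> has_derivative (\<lambda>e. fst e * A1 + snd e * A2)) (at 0)" "continuous_on UNIV \<Phi>"
    and \<Psi>: "(\<Psi> has_derivative (\<lambda>e. fst e * B1 + snd e * B2)) (at 0)" "continuous_on UNIV \<Psi>"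
    and r: "0 < r" and min: "\<And>e. norm e < r \<Longrightarrow> \<Psi> e = \<Psi> 0 \<Longrightarrow> \<Phi> 0 \<le> \<Phi> e"
  shows "A1 * B2 = A2 * B1"
proof (rule ccontr)
  define D where "D = A1 * B2 - A2 * B1"
  assume "A1 * B2 \<noteq> A2 * B1"
  then have D: "D \<noteq> 0" by (simp add: D_def)
  define f where "f e = (\<Phi> e, \<Psi> e)" for e
  define f' where "f' e = (fst e * A1 + snd e * A2, fst e * B1 + snd e * B2)" for e :: "real \<times> real"
  \<comment> \<open>The inverse of \<open>f'\<close> by Cramer's rule, with determinant
    \<open>D\<close>.\<close>
  define g' where "g' z = ((B2 * fst z - A2 * snd z) / D, (A1 * snd z - B1 * fst z) / D)" for z :: "real \<times> real"
  have "f 0 \<in> interior (f ` ball 0 r)"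
  proof (rule sussmann_open_mapping)
    show "open (UNIV :: (real \<times> real) set)" "0 \<in> (UNIV :: (real \<times> real) set)" "ball 0 r \<subseteq> (UNIV :: (real \<times> real) set)"
      by auto
    show "continuous_on UNIV f" unfolding f_def by (intro continuous_intros \<Phi> \<Psi>)
    show "(f has_derivative f') (at 0)"
      unfolding f_def f'_def by (intro has_derivative_Pair \<Phi> \<Psi>)
    show "bounded_linear g'"
      unfolding g'_def divide_inverse
      by (intro bounded_linear_Pair bounded_linear_mult_const bounded_linear_sub
          bounded_linear_const_mult bounded_linear_fst bounded_linear_snd)
    have "f' (g' z) = z" for z
    proof (cases z)
      case (Pair u v)
      have "((B2 * u - A2 * v) * A1 + (A1 * v - B1 * u) * A2) = u * D"
        "((B2 * u - A2 * v) * B1 + (A1 * v - B1 * u) * B2) = v * D"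
        by (simp_all add: D_def algebra_simps)
      then show ?thesis
        using D by (simp add: Pair f'_def g'_def add_divide_distrib[symmetric])
    qed
    then show "f' \<circ> g' = id" by auto
    show "0 \<in> interior (ball (0 :: real \<times> real) r)" using r by (simp add: interior_open)
  qed
  then obtain \<eta> where \<eta>: "0 < \<eta>" "ball (f 0) \<eta> \<subseteq> f ` ball 0 r"
    by (auto simp: mem_interior)
  have "(\<Phi> 0 - \<eta> / 2, \<Psi> 0) \<in> ball (f 0) \<eta>"
    using \<eta>(1) by (simp add: f_def dist_Pair_Pair dist_real_def)
  with \<eta>(2) obtain e where "e \<in> ball 0 r" "f e = (\<Phi> 0 - \<eta> / 2, \<Psi> 0)" by force
  then show False using min[of e] \<eta>(1) by (simp add: f_def)
qed

text \<open>Integrate by parts with \<open>Q\<close> a primitive of \<open>P\<close>: the boundary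
  terms vanish because the primitive of \<open>w\<close> is 0 at \<open>a\<close> and
  \<open>T\<close>. What remains says that \<open>w\<close> is orthogonal to \<open>Q + M\<close> on
  [a,T] and to \<open>N\<close> on [T,b] jointly. As \<open>w\<close> must be continuous at
  \<open>T\<close>, the two sides cannot be tested independently; \<open>N\<close> is removed
  first.\<close>

lemma du_Bois_Reymond:
  fixes a T b :: real and P M N :: "real \<Rightarrow> real"
  assumes aT: "a < T" and Tb: "T \<le> b"
    and P: "continuous_on {a..T} P" and M: "continuous_on {a..T} M" and N: "continuous_on {T..b} N"
    and H: "\<And>w. continuous_on {a..b} w \<Longrightarrow> integral {a..T} w = 0 \<Longrightarrow>
      integral {a..T} (\<lambda>t. P t * integral {a..t} w) - integral {a..T} (\<lambda>t. w t * M t)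
        - integral {T..b} (\<lambda>t. w t * N t) = 0"
  shows "t \<in> {a..T} \<Longrightarrow> (M has_real_derivative - P t) (at t within {a..T})"
    and "T < b \<Longrightarrow> t \<in> {T..b} \<Longrightarrow> N t = 0"
proof -
  define Q where "Q t = integral {a..t} P" for t
  have dQ: "(Q has_real_derivative P t) (at t within {a..T})" if "t \<in> {a..T}" for t
    unfolding Q_def using P that by (rule integral_has_real_derivative)
  have cQ: "continuous_on {a..T} Q"
    using dQ by (rule DERIV_continuous_on)
  define K where "K t = Q t + M t" for t
  have cK: "continuous_on {a..T} K" unfolding K_def by (intro continuous_intros cQ M)
  have H': "integral {a..T} (\<lambda>t. w t * K t) + integral {T..b} (\<lambda>t. w t * N t) = 0"
    if w: "continuous_on {a..b} w" and w0: "integral {a..T} w = 0" for w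
  proof -
    have wT: "continuous_on {a..T} w" using w Tb by (rule_tac continuous_on_subset) auto
    define h where "h t = integral {a..t} w" for t
    have dh: "(h has_real_derivative w t) (at t within {a..T})" if "t \<in> {a..T}" for t
      unfolding h_def using wT that by (rule integral_has_real_derivative)
    have ch: "continuous_on {a..T} h"
      using dh by (rule DERIV_continuous_on)
    have "((\<lambda>t. P t * h t + w t * Q t) has_integral Q T * h T - Q a * h a) {a..T}"
      using aT dQ dh
      by (intro fundamental_theorem_of_calculus)
        (auto simp: has_real_derivative_iff_has_vector_derivative[symmetric] intro!: derivative_eq_intros)
    then have "integral {a..T} (\<lambda>t. P t * h t + w t * Q t) = 0"
      using w0 by (simp add: integral_unique h_def)
    moreover have "integral {a..T} (\<lambda>t. P t * h t + w t * Q t) =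
        integral {a..T} (\<lambda>t. P t * h t) + integral {a..T} (\<lambda>t. w t * Q t)"
      by (intro integral_add integrable_continuous_real continuous_intros P ch wT cQ)
    moreover have "integral {a..T} (\<lambda>t. w t * K t) = integral {a..T} (\<lambda>t. w t * Q t) + integral {a..T} (\<lambda>t. w t * M t)"
      unfolding K_def distrib_left
      by (intro integral_add integrable_continuous_real continuous_intros M wT cQ)
    ultimately show ?thesis using H[OF w w0] by (simp add: h_def)
  qed
  show N0: "N t = 0" if Tb': "T < b" and t: "t \<in> {T..b}" for t
  proof -
    \<comment> \<open>On [a,T] this is 0, on [T,b] it is \<open>(t - T) * N t\<close>. The factor
      \<open>t - T\<close> buys continuity at \<open>T\<close> and loses the value there, which is
      recovered below from the closure.\<close>
    define w where "w t = (max T t - T) * N (max T t)" for t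
    have cw: "continuous_on {a..b} w"
      unfolding w_def using Tb by (intro continuous_intros continuous_on_compose2[OF N]) auto
    have w0: "w t = 0" if "t \<in> {a..T}" for t using that by (simp add: w_def max_def)
    have "integral {a..T} w = 0" "integral {a..T} (\<lambda>t. w t * K t) = 0"
      using integral_cong[of "{a..T}" w "\<lambda>_. 0"] integral_cong[of "{a..T}" "\<lambda>t. w t * K t" "\<lambda>_. 0"] w0
      by simp_all
    with H'[OF cw] have "integral {T..b} (\<lambda>t. w t * N t) = 0" by simp
    moreover have "integral {T..b} (\<lambda>t. w t * N t) = integral {T..b} (\<lambda>t. (t - T) * N t ^ 2)"
      by (intro integral_cong) (simp add: w_def max_def power2_eq_square)
    ultimately have "integral {T..b} (\<lambda>t. (t - T) * N t ^ 2) = 0" by simp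
    then have *: "\<forall>t\<in>{T..b}. (t - T) * N t ^ 2 = 0"
      using Tb' by (subst (asm) integral_eq_0_iff) (auto intro!: continuous_intros N)
    have "N s = 0" if "s \<in> {T<..b}" for s
      using *[rule_format, of s] that by simp
    then show ?thesis
      using continuous_constant_on_closure[of "{T<..b}" N 0 t] N Tb' t by simp
  qed
  show "(M has_real_derivative - P t) (at t within {a..T})" if t: "t \<in> {a..T}"
  proof -
    define m where "m = integral {a..T} K / (T - a)"
    \<comment> \<open>Subtracting the mean \<open>m\<close> makes \<open>w\<close> admissible, and
      then the integral of \<open>w\<close> squared equals that of \<open>w * K\<close>. The
      constant extension beyond \<open>T\<close> is harmless since \<open>N\<close> is already
      0.\<close>
    define w where "w t = K (min t T) - m" for t
    have cw: "continuous_on {a..b} w"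
      unfolding w_def using aT by (intro continuous_intros continuous_on_compose2[OF cK]) auto
    have weq: "w t = K t - m" if "t \<in> {a..T}" for t using that by (simp add: w_def min_def)
    have iK: "K integrable_on {a..T}" by (intro integrable_continuous_real cK)
    have "integral {a..T} w = integral {a..T} (\<lambda>t. K t - m)"
      by (rule integral_cong) (rule weq)
    also have "\<dots> = integral {a..T} K - integral {a..T} (\<lambda>t. m)"
      by (intro integral_diff iK integrable_const_ivl)
    also have "\<dots> = 0" using aT by (simp add: m_def)
    finally have w0: "integral {a..T} w = 0" .
    have "integral {T..b} (\<lambda>t. w t * N t) = 0"
    proof (cases "T < b")
      case True
      have "integral {T..b} (\<lambda>t. w t * N t) = integral {T..b} (\<lambda>_. 0)"
        by (rule integral_cong) (simp add: N0[OF True])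
      then show ?thesis by simp
    next
      case False
      then have "b = T" using Tb by simp
      then show ?thesis by simp
    qed
    with H'[OF cw w0] have wK: "integral {a..T} (\<lambda>t. w t * K t) = 0" by simp
    have cwT: "continuous_on {a..T} w" using cw Tb by (rule_tac continuous_on_subset) auto
    have "integral {a..T} (\<lambda>t. w t ^ 2) = integral {a..T} (\<lambda>t. w t * K t - m * w t)"
      by (rule integral_cong) (simp add: weq power2_eq_square algebra_simps)
    also have "\<dots> = integral {a..T} (\<lambda>t. w t * K t) - integral {a..T} (\<lambda>t. m * w t)"
      by (intro integral_diff integrable_continuous_real continuous_intros cwT cK)
    also have "\<dots> = 0" using wK w0 by simp
    finally have "integral {a..T} (\<lambda>t. w t ^ 2) = 0" .
    then have "\<forall>t\<in>{a..T}. w t ^ 2 = 0"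
      using aT by (subst (asm) integral_eq_0_iff) (auto intro!: continuous_intros cwT)
    then have Meq: "M s = m - Q s" if "s \<in> {a..T}" for s
      using weq[OF that] that by (force simp: K_def)
    have "((\<lambda>s. m - Q s) has_real_derivative - P t) (at t within {a..T})"
      using dQ[OF t] by (auto intro!: derivative_eq_intros)
    then show ?thesis
      by (rule has_field_derivative_transform_within[of _ _ _ _ 1]) (use t Meq in auto)
  qed
qed

subsection \<open>The combined Caputo derivative and its dual\<close>

lemma C1_on_imp_continuous_on: "C1_on f S \<Longrightarrow> continuous_on S f"
  unfolding C1_on_def by (meson has_derivative_continuous_on)

lemma C1_on_realI:
  fixes h :: "real \<Rightarrow> real"
  assumes "\<And>t. t \<in> S \<Longrightarrow> (h has_real_derivative w t) (at t within S)" and w: "continuous_on S w"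
  shows "C1_on h S"
  unfolding C1_on_def
proof (intro exI conjI ballI)
  show "continuous_on S (\<lambda>t. w t *\<^sub>R id_blinfun)" by (intro continuous_intros w)
  show "(h has_derivative blinfun_apply (w t *\<^sub>R id_blinfun)) (at t within S)" if "t \<in> S" for t
    using assms(1)[OF that]
    by (simp add: has_field_derivative_def scaleR_blinfun.rep_eq id_blinfun.rep_eq)
qed

lemma C1_on_realE:
  fixes h :: "real \<Rightarrow> real"
  assumes "C1_on h S"
  obtains w where "\<And>t. t \<in> S \<Longrightarrow> (h has_real_derivative w t) (at t within S)" "continuous_on S w"
proof -
  obtain h' where h': "\<And>t. t \<in> S \<Longrightarrow> (h has_derivative blinfun_apply (h' t)) (at t within S)"
    and c: "continuous_on S h'"
    using assms unfolding C1_on_def by blast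
  have "(h has_real_derivative h' t 1) (at t within S)" if "t \<in> S" for t
  proof (rule has_derivative_imp_has_field_derivative[OF h'[OF that]])
    show "x * h' t 1 = h' t x" for x
      using blinfun.scaleR_right[of "h' t" x 1] by simp
  qed
  moreover have "continuous_on S (\<lambda>t. h' t 1)" by (intro continuous_intros c)
  ultimately show ?thesis by (rule that)
qed

text \<open>The combined Caputo derivative as an operator on x' instead of x; the minus sign is that
  of the right Caputo derivative.\<close>

definition comb_RL_int ::
  "real \<times> real \<Rightarrow> (real \<times> real \<Rightarrow> real) \<Rightarrow> (real \<times> real \<Rightarrow> real) \<Rightarrow> real \<Rightarrow> real \<Rightarrow>
     (real \<Rightarrow> real) \<Rightarrow> real \<Rightarrow> real" where
  "comb_RL_int \<gamma> \<alpha> \<beta> a b w t = fst \<gamma> * RL_int_left \<alpha> a w t - snd \<gamma> * RL_int_right \<beta> b w t"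

lemma comb_caputo_eq:
  assumes "a < b" and t: "t \<in> {a..b}"
    and y: "\<And>s. s \<in> {a..b} \<Longrightarrow> (y has_real_derivative w s) (at s within {a..b})"
  shows "comb_caputo \<gamma> \<alpha> \<beta> a b y t = comb_RL_int \<gamma> \<alpha> \<beta> a b w t"
proof -
  have "vector_derivative y (at s within {a..b}) = w s" if "s \<in> {a..b}" for s
    using y[OF that] that \<open>a < b\<close> vector_derivative_within_cbox[of a b s y "w s"]
    by (auto simp: has_real_derivative_iff_has_vector_derivative)
  then have "RL_int_left \<alpha> a (\<lambda>\<tau>. vector_derivative y (at \<tau> within {a..b})) t = RL_int_left \<alpha> a w t"
    "RL_int_right \<beta> b (\<lambda>\<tau>. vector_derivative y (at \<tau> within {a..b})) t = RL_int_right \<beta> b w t"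
    unfolding RL_int_left_def RL_int_right_def using t by (auto intro!: integral_cong)
  then show ?thesis
    by (simp add: comb_caputo_def comb_RL_int_def caputo_left_def caputo_right_def)
qed

locale variable_orders =
  fixes a b :: real and \<alpha> \<beta> :: "real \<times> real \<Rightarrow> real"
  assumes ab: "a < b"
    and \<alpha>: "continuous_on ({a..b} \<times> {a..b}) \<alpha>" "\<And>p. p \<in> {a..b} \<times> {a..b} \<Longrightarrow> 0 < \<alpha> p \<and> \<alpha> p < 1"
    and \<beta>: "continuous_on ({a..b} \<times> {a..b}) \<beta>" "\<And>p. p \<in> {a..b} \<times> {a..b} \<Longrightarrow> 0 < \<beta> p \<and> \<beta> p < 1"
begin

lemma comb_RL_int_continuous:
  assumes "continuous_on {a..b} w"
  shows "continuous_on {a..b} (comb_RL_int \<gamma> \<alpha> \<beta> a b w)"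
proof -
  obtain q k e where A: "sing_approx a b q (RL_kernel \<alpha>) k e"
    using RL_kernel_sing_approx[OF _ \<alpha>] ab by force
  obtain q' k' e' where B: "sing_approx a b q' (RL_kernel \<beta>) k' e'"
    using RL_kernel_sing_approx[OF _ \<beta>] ab by force
  show ?thesis
    unfolding comb_RL_int_def
    by (intro continuous_intros RL_int_left_continuous[OF A] RL_int_right_continuous[OF B] assms order_refl)
qed

lemma comb_RL_int_linear:
  assumes "t \<in> {a..b}" "continuous_on {a..b} u" "continuous_on {a..b} v"
  shows "comb_RL_int \<gamma> \<alpha> \<beta> a b (\<lambda>s. A * u s + B * v s) t =
    A * comb_RL_int \<gamma> \<alpha> \<beta> a b u t + B * comb_RL_int \<gamma> \<alpha> \<beta> a b v t"
proof -
  obtain q k e where S: "sing_approx a b q (RL_kernel \<alpha>) k e"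
    using RL_kernel_sing_approx[OF _ \<alpha>] ab by force
  obtain q' k' e' where S': "sing_approx a b q' (RL_kernel \<beta>) k' e'"
    using RL_kernel_sing_approx[OF _ \<beta>] ab by force
  show ?thesis
    using RL_int_left_linear[OF S assms, of A B] RL_int_right_linear[OF S' assms, of A B]
    by (simp add: comb_RL_int_def algebra_simps)
qed

lemma dual_int_continuous:
  assumes "a \<le> T" "T \<le> b" and f: "continuous_on {a..b} f"
  shows "continuous_on {a..T} (dual_int \<gamma> \<alpha> \<beta> a T f)"
    and "continuous_on {T..b} (\<lambda>s. snd \<gamma> * (RL_int_left \<beta> a f s - RL_int_left \<beta> T f s))"
proof -
  obtain q k e where A: "sing_approx a b q (RL_kernel \<alpha>) k e"
    using RL_kernel_sing_approx[OF _ \<alpha>] ab by force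
  obtain q' k' e' where B: "sing_approx a b q' (RL_kernel \<beta>) k' e'"
    using RL_kernel_sing_approx[OF _ \<beta>] ab by force
  have l: "continuous_on {a..b} (RL_int_left \<beta> a f)"
    by (rule RL_int_left_continuous[OF B order_refl f])
  have T: "continuous_on {T..b} (RL_int_left \<beta> T f)"
    using assms by (intro RL_int_left_continuous[OF B]) (auto elim: continuous_on_subset)
  have r: "continuous_on {a..T} (RL_int_right \<alpha> T f)"
    using assms by (intro RL_int_right_continuous[OF A]) (auto elim: continuous_on_subset)
  show "continuous_on {a..T} (dual_int \<gamma> \<alpha> \<beta> a T f)"
    unfolding dual_int_def using assms by (intro continuous_intros r continuous_on_subset[OF l]) auto
  show "continuous_on {T..b} (\<lambda>s. snd \<gamma> * (RL_int_left \<beta> a f s - RL_int_left \<beta> T f s))"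
    using assms by (intro continuous_intros T continuous_on_subset[OF l]) auto
qed

text \<open>Fractional integration by parts. The last integral is the contribution of the right
  Caputo derivative from beyond \<open>T\<close>.\<close>

lemma integral_mult_comb_RL_int:
  assumes T: "a \<le> T" "T \<le> b" and f: "continuous_on {a..b} f" and w: "continuous_on {a..b} w"
  shows "integral {a..T} (\<lambda>t. f t * comb_RL_int \<gamma> \<alpha> \<beta> a b w t) =
    - integral {a..T} (\<lambda>s. w s * dual_int \<gamma> \<alpha> \<beta> a T f s)
    - integral {T..b} (\<lambda>s. w s * (snd \<gamma> * (RL_int_left \<beta> a f s - RL_int_left \<beta> T f s)))"
proof -
  obtain q k e where A: "sing_approx a b q (RL_kernel \<alpha>) k e"
    using RL_kernel_sing_approx[OF _ \<alpha>] ab by force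
  obtain q' k' e' where B: "sing_approx a b q' (RL_kernel \<beta>) k' e'"
    using RL_kernel_sing_approx[OF _ \<beta>] ab by force
  have sub: "continuous_on {a..T} u" if "continuous_on {a..b} u" for u :: "real \<Rightarrow> real"
    using that T by (rule_tac continuous_on_subset) auto
  have lw: "continuous_on {a..T} (RL_int_left \<alpha> a w)"
    by (intro sub RL_int_left_continuous[OF A order_refl w])
  have rw: "continuous_on {a..T} (RL_int_right \<beta> b w)"
    by (intro sub RL_int_right_continuous[OF B order_refl w])
  have lf: "continuous_on {a..T} (RL_int_left \<beta> a f)"
    by (intro sub RL_int_left_continuous[OF B order_refl f])
  have rf: "continuous_on {a..T} (RL_int_right \<alpha> T f)"
    by (intro RL_int_right_continuous[OF A T(2)] sub f)
  have "integral {a..T} (\<lambda>t. f t * comb_RL_int \<gamma> \<alpha> \<beta> a b w t) =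
    integral {a..T} (\<lambda>t. fst \<gamma> * (f t * RL_int_left \<alpha> a w t) - snd \<gamma> * (f t * RL_int_right \<beta> b w t))"
    by (simp add: comb_RL_int_def algebra_simps)
  also have "\<dots> = fst \<gamma> * integral {a..T} (\<lambda>t. f t * RL_int_left \<alpha> a w t)
      - snd \<gamma> * integral {a..T} (\<lambda>t. f t * RL_int_right \<beta> b w t)"
    unfolding integral_mult_right[symmetric]
    by (intro integral_diff integrable_continuous_real continuous_intros sub f lw rw)
  also have "integral {a..T} (\<lambda>t. f t * RL_int_left \<alpha> a w t) = integral {a..T} (\<lambda>s. w s * RL_int_right \<alpha> T f s)"
    by (rule RL_int_Fubini_left[OF A T(2) sub[OF f] sub[OF w]])
  also have "integral {a..T} (\<lambda>t. f t * RL_int_right \<beta> b w t) = integral {a..T} (\<lambda>s. w s * RL_int_left \<beta> a f s) +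
    integral {T..b} (\<lambda>s. w s * (RL_int_left \<beta> a f s - RL_int_left \<beta> T f s))"
    by (rule RL_int_Fubini_right[OF B T f w])
  finally have 1: "integral {a..T} (\<lambda>t. f t * comb_RL_int \<gamma> \<alpha> \<beta> a b w t) =
    fst \<gamma> * integral {a..T} (\<lambda>s. w s * RL_int_right \<alpha> T f s) - snd \<gamma> * (integral {a..T} (\<lambda>s. w s * RL_int_left \<beta> a f s) +
    integral {T..b} (\<lambda>s. w s * (RL_int_left \<beta> a f s - RL_int_left \<beta> T f s)))" .
  have "integral {a..T} (\<lambda>s. w s * dual_int \<gamma> \<alpha> \<beta> a T f s) =
    integral {a..T} (\<lambda>s. snd \<gamma> * (w s * RL_int_left \<beta> a f s) - fst \<gamma> * (w s * RL_int_right \<alpha> T f s))"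
    by (simp add: dual_int_def algebra_simps)
  also have "\<dots> = snd \<gamma> * integral {a..T} (\<lambda>s. w s * RL_int_left \<beta> a f s)
      - fst \<gamma> * integral {a..T} (\<lambda>s. w s * RL_int_right \<alpha> T f s)"
    unfolding integral_mult_right[symmetric]
    by (intro integral_diff integrable_continuous_real continuous_intros sub w lf rf)
  finally have 2: "integral {a..T} (\<lambda>s. w s * dual_int \<gamma> \<alpha> \<beta> a T f s) =
    snd \<gamma> * integral {a..T} (\<lambda>s. w s * RL_int_left \<beta> a f s) - fst \<gamma> * integral {a..T} (\<lambda>s. w s * RL_int_right \<alpha> T f s)" .
  have 3: "integral {T..b} (\<lambda>s. w s * (snd \<gamma> * (RL_int_left \<beta> a f s - RL_int_left \<beta> T f s))) =
    snd \<gamma> * integral {T..b} (\<lambda>s. w s * (RL_int_left \<beta> a f s - RL_int_left \<beta> T f s))"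
    unfolding integral_mult_right[symmetric] by (simp add: mult_ac)
  show ?thesis unfolding 1 2 3 by (simp add: algebra_simps)
qed

end

section \<open>From the antiderivatives to the Riemann-Liouville derivatives\<close>

text \<open>The existence hypotheses force a < t < T, so the derivative within [a,T] is unique. The
  left derivative, taken within [a,b], is restricted to [a,T]; the minus signs in
  \<open>dual_int\<close> and \<open>RL_deriv_right\<close> cancel.\<close>

lemma dual_deriv_eq:
  assumes ab: "a < b" "T \<le> b"
    and d: "(dual_int \<gamma> \<alpha> \<beta> a T f has_real_derivative d) (at t within {a..T})"
    and l: "has_RL_deriv_left \<beta> b a f t" and r: "has_RL_deriv_right \<alpha> a T f t"
  shows "dual_deriv \<gamma> \<alpha> \<beta> a b T f t = d"
proof -
  have t: "a < t" "t < T" using l r by (auto simp: has_RL_deriv_left_def has_RL_deriv_right_def)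
  have "(RL_int_left \<beta> a f has_vector_derivative RL_deriv_left \<beta> b a f t) (at t within {a..b})"
    using l unfolding has_RL_deriv_left_def RL_deriv_left_def vector_derivative_works by simp
  then have L: "(RL_int_left \<beta> a f has_real_derivative RL_deriv_left \<beta> b a f t) (at t within {a..T})"
    unfolding has_real_derivative_iff_has_vector_derivative
    by (rule has_vector_derivative_within_subset) (use ab in auto)
  have "(RL_int_right \<alpha> T f has_vector_derivative - RL_deriv_right \<alpha> a T f t) (at t within {a..T})"
    using r unfolding has_RL_deriv_right_def RL_deriv_right_def vector_derivative_works by simp
  then have R: "(RL_int_right \<alpha> T f has_real_derivative - RL_deriv_right \<alpha> a T f t) (at t within {a..T})"
    by (simp add: has_real_derivative_iff_has_vector_derivative)
  have "(dual_int \<gamma> \<alpha> \<beta> a T f has_real_derivative dual_deriv \<gamma> \<alpha> \<beta> a b T f t) (at t within {a..T})"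
    unfolding dual_int_def dual_deriv_def
    by (rule DERIV_cong[OF DERIV_diff[OF DERIV_cmult[OF L] DERIV_cmult[OF R]]]) simp
  with d show ?thesis
    unfolding has_real_derivative_iff_has_vector_derivative
    by (rule_tac vector_derivative_unique_within_closed_interval[of a T t]) (use t in auto)
qed

lemma RL_deriv_left_diff_eq:
  assumes ab: "a \<le> T"
    and d: "((\<lambda>s. c * (RL_int_left \<beta> a f s - RL_int_left \<beta> T f s)) has_real_derivative d) (at t within {T..b})"
    and l: "has_RL_deriv_left \<beta> b a f t" and r: "has_RL_deriv_left \<beta> b T f t"
  shows "c * (RL_deriv_left \<beta> b a f t - RL_deriv_left \<beta> b T f t) = d"
proof -
  have t: "T < t" "t \<le> b" using r by (auto simp: has_RL_deriv_left_def)
  have "(RL_int_left \<beta> a f has_vector_derivative RL_deriv_left \<beta> b a f t) (at t within {a..b})"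
    using l unfolding has_RL_deriv_left_def RL_deriv_left_def vector_derivative_works by simp
  then have L: "(RL_int_left \<beta> a f has_real_derivative RL_deriv_left \<beta> b a f t) (at t within {T..b})"
    unfolding has_real_derivative_iff_has_vector_derivative
    by (rule has_vector_derivative_within_subset) (use ab in auto)
  have R: "(RL_int_left \<beta> T f has_real_derivative RL_deriv_left \<beta> b T f t) (at t within {T..b})"
    using r unfolding has_RL_deriv_left_def RL_deriv_left_def vector_derivative_works
      has_real_derivative_iff_has_vector_derivative by simp
  have "((\<lambda>s. c * (RL_int_left \<beta> a f s - RL_int_left \<beta> T f s)) has_real_derivative
      c * (RL_deriv_left \<beta> b a f t - RL_deriv_left \<beta> b T f t)) (at t within {T..b})"
    by (intro DERIV_cmult DERIV_diff L R)
  with d show ?thesis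
    unfolding has_real_derivative_iff_has_vector_derivative
    by (rule_tac vector_derivative_unique_within_closed_interval[of T b t]) (use t in auto)
qed

subsection \<open>Euler--Lagrange equations\<close>

context variable_orders
begin

text \<open>
  Since \<open>h = \<integral> w\<close> vanishes at \<open>a\<close> and at \<open>T\<close>, varying \<open>x\<close> along \<open>h\<close> with \<open>T\<close> fixed changes neither the
  boundary value nor the terminal cost \<open>\<phi>\<close>.
\<close>

lemma first_variations_proportional:
  fixes L g :: "real \<times> real \<times> real \<Rightarrow> real" and x \<psi> :: "real \<Rightarrow> real" and \<phi> :: "real \<times> real \<Rightarrow> real"
  assumes aT: "a \<le> T" "T \<le> b"
    and L: "L differentiable_on {a..b} \<times> UNIV \<times> UNIV"
      "continuous_on ({a..b} \<times> UNIV \<times> UNIV) (partial2 L)"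
      "continuous_on ({a..b} \<times> UNIV \<times> UNIV) (partial3 L)"
    and g: "g differentiable_on {a..b} \<times> UNIV \<times> UNIV"
      "continuous_on ({a..b} \<times> UNIV \<times> UNIV) (partial2 g)"
      "continuous_on ({a..b} \<times> UNIV \<times> UNIV) (partial3 g)"
    and min: "local_min_on \<gamma> \<alpha> \<beta> a b
      (\<lambda>y S. integral {a..S} (\<lambda>t. L (along \<gamma> \<alpha> \<beta> a b y t)) + \<phi> (S, y S))
      {(y, S) \<in> D_space \<gamma> \<alpha> \<beta> a b. y a = xa \<and> integral {a..S} (\<lambda>t. g (along \<gamma> \<alpha> \<beta> a b y t)) = \<psi> S} x T"
    and w: "continuous_on {a..b} w1" "integral {a..T} w1 = 0" "continuous_on {a..b} w2" "integral {a..T} w2 = 0"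
  defines "\<And>G w. V G w \<equiv> integral {a..T} (\<lambda>t. partial2 G (along \<gamma> \<alpha> \<beta> a b x t) * integral {a..t} w
      + partial3 G (along \<gamma> \<alpha> \<beta> a b x t) * comb_RL_int \<gamma> \<alpha> \<beta> a b w t)"
  shows "V L w1 * V g w2 = V L w2 * V g w1"
proof -
  define A where "A = {(y, S) \<in> D_space \<gamma> \<alpha> \<beta> a b. y a = xa \<and> integral {a..S} (\<lambda>t. g (along \<gamma> \<alpha> \<beta> a b y t)) = \<psi> S}"
  have xA: "(x, T) \<in> A" using min by (simp add: local_min_on_def A_def)
  obtain \<epsilon> where \<epsilon>: "0 < \<epsilon>" and minA: "\<And>y. (y, T) \<in> A \<Longrightarrow> D_norm \<gamma> \<alpha> \<beta> a b (\<lambda>s. y s - x s, 0) < \<epsilon> \<Longrightarrow>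
      integral {a..T} (\<lambda>t. L (along \<gamma> \<alpha> \<beta> a b x t)) + \<phi> (T, x T)
      \<le> integral {a..T} (\<lambda>t. L (along \<gamma> \<alpha> \<beta> a b y t)) + \<phi> (T, y T)"
    using min unfolding local_min_on_def A_def[symmetric] by fastforce
  have "C1_on x {a..b}" using xA by (simp add: A_def D_space_def)
  then obtain x' where x': "\<And>t. t \<in> {a..b} \<Longrightarrow> (x has_real_derivative x' t) (at t within {a..b})"
    and cx': "continuous_on {a..b} x'" by (rule C1_on_realE) blast
  define h1 where "h1 t = integral {a..t} w1" for t
  define h2 where "h2 t = integral {a..t} w2" for t
  define c1 where "c1 = comb_RL_int \<gamma> \<alpha> \<beta> a b w1"
  define c2 where "c2 = comb_RL_int \<gamma> \<alpha> \<beta> a b w2"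
  define v where "v = comb_caputo \<gamma> \<alpha> \<beta> a b x"
  have dh: "(h1 has_real_derivative w1 t) (at t within {a..b})" "(h2 has_real_derivative w2 t) (at t within {a..b})"
    if "t \<in> {a..b}" for t
    unfolding h1_def h2_def using w that by (auto intro: integral_has_real_derivative)
  have h0: "h1 a = 0" "h2 a = 0" "h1 T = 0" "h2 T = 0" using w by (simp_all add: h1_def h2_def)
  have v: "v t = comb_RL_int \<gamma> \<alpha> \<beta> a b x' t" if "t \<in> {a..b}" for t
    unfolding v_def using comb_caputo_eq[OF ab that x'] .
  have cont: "continuous_on {a..b} x" "continuous_on {a..b} v" "continuous_on {a..b} h1" "continuous_on {a..b} c1"
    "continuous_on {a..b} h2" "continuous_on {a..b} c2"
    using DERIV_continuous_on[OF x'] DERIV_continuous_on[OF dh(1)] DERIV_continuous_on[OF dh(2)] xA w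
    by (auto simp: v_def c1_def c2_def A_def D_space_def intro!: comb_RL_int_continuous)
  have sub: "continuous_on {a..T} u" if "continuous_on {a..b} u" for u :: "real \<Rightarrow> real"
    using that aT by (rule_tac continuous_on_subset) auto
  define d where "d e t = fst e * h1 t + snd e * h2 t" for e :: "real \<times> real" and t
  define wd where "wd e t = fst e * w1 t + snd e * w2 t" for e :: "real \<times> real" and t
  have cwd: "continuous_on {a..b} (wd e)" for e
    unfolding wd_def by (intro continuous_intros w)
  have d: "(d e has_real_derivative wd e t) (at t within {a..b})" if "t \<in> {a..b}" for e t
    unfolding d_def wd_def by (intro DERIV_add DERIV_cmult dh that)
  have cd: "comb_caputo \<gamma> \<alpha> \<beta> a b (d e) t = fst e * c1 t + snd e * c2 t" if "t \<in> {a..b}" for e t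
    using comb_caputo_eq[OF ab that d] comb_RL_int_linear[OF that w(1,3), of \<gamma> "fst e" "snd e"]
    by (simp add: wd_def c1_def c2_def)
  \<comment> \<open>The factors 1 give the derivative the shape of
    \<open>comb_RL_int_linear\<close>.\<close>
  have dy: "((\<lambda>s. x s + d e s) has_real_derivative 1 * x' t + 1 * wd e t) (at t within {a..b})"
    if "t \<in> {a..b}" for e t
    using DERIV_add[OF x'[OF that] d[OF that]] by simp
  have cy: "comb_caputo \<gamma> \<alpha> \<beta> a b (\<lambda>s. x s + d e s) t = v t + (fst e * c1 t + snd e * c2 t)"
    if "t \<in> {a..b}" for e t
    using comb_caputo_eq[OF ab that dy] comb_RL_int_linear[OF that cx' cwd, of \<gamma> 1 1 e]
      comb_RL_int_linear[OF that w(1,3), of \<gamma> "fst e" "snd e"] v[OF that]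
    by (simp add: wd_def[abs_def] c1_def c2_def)
  define \<Phi> where "\<Phi> G e = integral {a..T} (\<lambda>t. G (t, x t + (fst e * h1 t + snd e * h2 t), v t + (fst e * c1 t + snd e * c2 t)))"
    for G :: "real \<times> real \<times> real \<Rightarrow> real" and e :: "real \<times> real"
  have \<Phi>: "integral {a..T} (\<lambda>t. G (along \<gamma> \<alpha> \<beta> a b (\<lambda>s. x s + d e s) t)) = \<Phi> G e" for G e
    unfolding \<Phi>_def using aT by (intro integral_cong) (simp add: along_def cy, simp add: d_def)
  have \<Phi>0: "integral {a..T} (\<lambda>t. G (along \<gamma> \<alpha> \<beta> a b x t)) = \<Phi> G 0" for G
    by (simp add: \<Phi>_def along_def v_def)
  have V: "V G w1 = integral {a..T} (\<lambda>t. partial2 G (t, x t, v t) * h1 t + partial3 G (t, x t, v t) * c1 t)"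
    "V G w2 = integral {a..T} (\<lambda>t. partial2 G (t, x t, v t) * h2 t + partial3 G (t, x t, v t) * c2 t)" for G
    by (simp_all add: V_def along_def v_def h1_def h2_def c1_def c2_def)
  have var: "(\<Phi> G has_derivative (\<lambda>e. fst e * V G w1 + snd e * V G w2)) (at 0)" "continuous_on UNIV (\<Phi> G)"
    if "G differentiable_on {a..b} \<times> UNIV \<times> UNIV"
      "continuous_on ({a..b} \<times> UNIV \<times> UNIV) (partial2 G)"
      "continuous_on ({a..b} \<times> UNIV \<times> UNIV) (partial3 G)" for G
    using first_variation[OF that aT(2) cont[THEN sub]] unfolding \<Phi>_def[abs_def] V by auto
  \<comment> \<open>One bound \<open>B\<close> for all four functions: each supremum in the norm of
    \<open>d e\<close> is at most \<open>2 * norm e * B\<close>, and the time component is 0. This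
    is the origin of the radius \<open>\<epsilon> / (4 * B)\<close>.\<close>
  have "bounded (\<Union>u\<in>{h1, h2, c1, c2}. u ` {a..b})"
    using cont by (auto intro!: compact_imp_bounded compact_continuous_image)
  then obtain B where B: "0 < B" "\<And>t. t \<in> {a..b} \<Longrightarrow> \<bar>h1 t\<bar> \<le> B \<and> \<bar>h2 t\<bar> \<le> B \<and> \<bar>c1 t\<bar> \<le> B \<and> \<bar>c2 t\<bar> \<le> B"
    unfolding bounded_pos by fastforce
  have bd: "\<bar>fst e * p + snd e * q\<bar> \<le> 2 * norm e * B" if "\<bar>p\<bar> \<le> B" "\<bar>q\<bar> \<le> B" for e :: "real \<times> real" and p q
  proof -
    have "\<bar>fst e\<bar> * \<bar>p\<bar> \<le> norm e * B" "\<bar>snd e\<bar> * \<bar>q\<bar> \<le> norm e * B"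
      using that norm_fst_le[of "fst e" "snd e"] norm_snd_le[of "snd e" "fst e"] by (auto intro!: mult_mono)
    then show ?thesis
      using abs_triangle_ineq[of "fst e * p" "snd e * q"] by (simp add: abs_mult)
  qed
  have norm_le: "D_norm \<gamma> \<alpha> \<beta> a b (d e, 0) \<le> 4 * norm e * B" for e
  proof -
    have "(SUP s\<in>{a..b}. \<bar>d e s\<bar>) \<le> 2 * norm e * B"
      using ab B(2) bd by (intro cSUP_least) (auto simp: d_def)
    moreover have "(SUP s\<in>{a..b}. \<bar>comb_caputo \<gamma> \<alpha> \<beta> a b (d e) s\<bar>) \<le> 2 * norm e * B"
      using ab B(2) bd by (intro cSUP_least) (auto simp: cd)
    ultimately show ?thesis by (simp add: D_norm_def)
  qed
  show ?thesis
  proof (rule constrained_min_det_eq_0[OF var[OF L] var[OF g]])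
    show "0 < \<epsilon> / (4 * B)" using \<epsilon> B by simp
    fix e :: "real \<times> real" assume e: "norm e < \<epsilon> / (4 * B)" and eq: "\<Phi> g e = \<Phi> g 0"
    have "(\<lambda>s. x s + d e s, T) \<in> A"
    proof -
      have "C1_on (\<lambda>s. x s + d e s) {a..b}"
        by (rule C1_on_realI[OF dy]) (auto intro!: continuous_intros cx' cwd)
      moreover have "continuous_on {a..b} (comb_caputo \<gamma> \<alpha> \<beta> a b (\<lambda>s. x s + d e s))"
        by (rule continuous_on_eq[of _ "\<lambda>t. v t + (fst e * c1 t + snd e * c2 t)"])
          (auto intro!: continuous_intros cont simp: cy)
      ultimately show ?thesis
        using xA eq by (simp add: A_def D_space_def \<Phi> \<Phi>0) (simp add: d_def h0)
    qed
    moreover have "D_norm \<gamma> \<alpha> \<beta> a b (d e, 0) < \<epsilon>"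
      using norm_le[of e] e B(1) by (simp add: field_simps)
    ultimately have "integral {a..T} (\<lambda>t. L (along \<gamma> \<alpha> \<beta> a b x t)) + \<phi> (T, x T)
      \<le> integral {a..T} (\<lambda>t. L (along \<gamma> \<alpha> \<beta> a b (\<lambda>s. x s + d e s) t)) + \<phi> (T, x T + d e T)"
      using minA[of "\<lambda>s. x s + d e s"] by simp
    moreover have "d e T = 0" by (simp add: d_def h0)
    ultimately show "\<Phi> L 0 \<le> \<Phi> L e"
      by (simp add: \<Phi> \<Phi>0)
  qed
qed

end

section \<open>Assembly of the multipliers and the two equations\<close>

theorem theorem53:
  fixes a b xa T :: real
    and \<alpha> \<beta> :: "real \<times> real \<Rightarrow> real"
    and \<gamma> :: "real \<times> real"
    and L g :: "real \<times> real \<times> real \<Rightarrow> real"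
    and \<phi> :: "real \<times> real \<Rightarrow> real"
    and \<psi> x :: "real \<Rightarrow> real"
  assumes "a < b"
    and "continuous_on ({a..b} \<times> {a..b}) \<alpha>"
    and "\<And>p. p \<in> {a..b} \<times> {a..b} \<Longrightarrow> 0 < \<alpha> p \<and> \<alpha> p < 1"
    and "continuous_on ({a..b} \<times> {a..b}) \<beta>"
    and "\<And>p. p \<in> {a..b} \<times> {a..b} \<Longrightarrow> 0 < \<beta> p \<and> \<beta> p < 1"
    and "\<gamma> \<in> {0..1} \<times> {0..1}" and "\<gamma> \<noteq> (0, 0)"
    and "L differentiable_on {a..b} \<times> UNIV \<times> UNIV"
    and "continuous_on ({a..b} \<times> UNIV \<times> UNIV) (partial2 L)"
    and "continuous_on ({a..b} \<times> UNIV \<times> UNIV) (partial3 L)"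
    and "C1_on \<phi> ({a..b} \<times> UNIV)"
    and "C1_on g ({a..b} \<times> UNIV \<times> UNIV)"
    and "\<psi> differentiable_on {a..b}"
    and "local_min_on \<gamma> \<alpha> \<beta> a b
           (\<lambda>y S. integral {a..S} (\<lambda>t. L (along \<gamma> \<alpha> \<beta> a b y t)) + \<phi> (S, y S))
           {(y, S) \<in> D_space \<gamma> \<alpha> \<beta> a b. y a = xa \<and> integral {a..S} (\<lambda>t. g (along \<gamma> \<alpha> \<beta> a b y t)) = \<psi> S}
           x T"
  shows "\<exists>l0 l :: real. (l0, l) \<noteq> (0, 0) \<and>
    (let F = (\<lambda>p. l0 * L p - l * g p);
         f = (\<lambda>t. partial3 F (along \<gamma> \<alpha> \<beta> a b x t))
     in (\<forall>t\<in>{a..T}.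
           (dual_int \<gamma> \<alpha> \<beta> a T f has_real_derivative - partial2 F (along \<gamma> \<alpha> \<beta> a b x t)) (at t within {a..T}) \<and>
           (has_RL_deriv_left \<beta> b a f t \<and> has_RL_deriv_right \<alpha> a T f t \<longrightarrow>
              partial2 F (along \<gamma> \<alpha> \<beta> a b x t) + dual_deriv \<gamma> \<alpha> \<beta> a b T f t = 0)) \<and>
        (\<forall>t\<in>{T..b}.
           ((\<lambda>s. snd \<gamma> * (RL_int_left \<beta> a f s - RL_int_left \<beta> T f s)) has_real_derivative 0)
              (at t within {T..b}) \<and>
           (has_RL_deriv_left \<beta> b a f t \<and> has_RL_deriv_left \<beta> b T f t \<longrightarrow>
              snd \<gamma> * (RL_deriv_left \<beta> b a f t - RL_deriv_left \<beta> b T f t) = 0)))"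
proof -
  note L = assms(8-10) and g = C1_on_partials[OF assms(12)] and min = assms(14)
  interpret variable_orders a b \<alpha> \<beta> by unfold_locales (use assms in blast)+
  have T: "a \<le> T" "T \<le> b" and xD: "(x, T) \<in> D_space \<gamma> \<alpha> \<beta> a b"
    using min by (auto simp: local_min_on_def D_space_def)
  let ?z = "along \<gamma> \<alpha> \<beta> a b x"
  \<comment> \<open>Derivatives of the variations; zero integral means that the variation vanishes
    at \<open>T\<close>.\<close>
  define W :: "(real \<Rightarrow> real) set" where "W = {w. continuous_on {a..b} w \<and> integral {a..T} w = 0}"
  define V where "V G w = integral {a..T} (\<lambda>t. partial2 G (?z t) * integral {a..t} w
      + partial3 G (?z t) * comb_RL_int \<gamma> \<alpha> \<beta> a b w t)" for G and w :: "real \<Rightarrow> real"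
  have "V L w1 * V g w2 = V L w2 * V g w1" if "w1 \<in> W" "w2 \<in> W" for w1 w2
    using first_variations_proportional[OF T L g min, of w1 w2] that by (simp add: W_def V_def)
  from lagrange_multiplier_of_proportional[of W "V L" "V g", OF this]
  obtain l0 l where l: "(l0, l) \<noteq> (0, 0)" and lV: "\<And>w. w \<in> W \<Longrightarrow> l0 * V L w - l * V g w = 0" by blast
  define F where "F p = l0 * L p - l * g p" for p
  define f where "f t = partial3 F (?z t)" for t
  define P where "P t = partial2 F (?z t)" for t
  define N where "N s = snd \<gamma> * (RL_int_left \<beta> a f s - RL_int_left \<beta> T f s)" for s
  have f: "f t = l0 * partial3 L (?z t) - l * partial3 g (?z t)"
    and P: "P t = l0 * partial2 L (?z t) - l * partial2 g (?z t)" if "t \<in> {a..b}" for t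
    using partial_diff_scaled[OF L(1) g(1) that] by (simp_all add: f_def P_def F_def[abs_def] along_def)
  have cz: "continuous_on {a..b} ?z"
    unfolding along_def using xD C1_on_imp_continuous_on[of x]
    by (auto simp: D_space_def intro!: continuous_intros)
  have zS: "?z ` {a..b} \<subseteq> {a..b} \<times> UNIV \<times> UNIV" by (auto simp: along_def)
  have cp: "continuous_on {a..b} (\<lambda>t. partial2 L (?z t))" "continuous_on {a..b} (\<lambda>t. partial3 L (?z t))"
    "continuous_on {a..b} (\<lambda>t. partial2 g (?z t))" "continuous_on {a..b} (\<lambda>t. partial3 g (?z t))"
    using L g cz zS by (auto intro: continuous_on_compose2)
  have cf: "continuous_on {a..b} f"
    by (rule continuous_on_eq[of _ "\<lambda>t. l0 * partial3 L (?z t) - l * partial3 g (?z t)"])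
      (auto intro!: continuous_intros cp simp: f)
  have cP: "continuous_on {a..b} P"
    by (rule continuous_on_eq[of _ "\<lambda>t. l0 * partial2 L (?z t) - l * partial2 g (?z t)"])
      (auto intro!: continuous_intros cp simp: P)
  have sub: "continuous_on {a..T} u" if "continuous_on {a..b} u" for u :: "real \<Rightarrow> real"
    using that T by (rule_tac continuous_on_subset) auto
  have H: "integral {a..T} (\<lambda>t. P t * integral {a..t} w) - integral {a..T} (\<lambda>t. w t * dual_int \<gamma> \<alpha> \<beta> a T f t)
      - integral {T..b} (\<lambda>t. w t * N t) = 0"
    if w: "continuous_on {a..b} w" "integral {a..T} w = 0" for w
  proof -
    let ?h = "\<lambda>t. integral {a..t} w" and ?c = "comb_RL_int \<gamma> \<alpha> \<beta> a b w"
    have ch: "continuous_on {a..b} ?h"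
      by (rule DERIV_continuous_on) (rule integral_has_real_derivative[OF w(1)])
    have cc: "continuous_on {a..b} ?c" by (rule comb_RL_int_continuous[OF w(1)])
    have "0 = l0 * V L w - l * V g w" using lV[of w] w by (simp add: W_def)
    also have "\<dots> = integral {a..T} (\<lambda>t. l0 * (partial2 L (?z t) * ?h t + partial3 L (?z t) * ?c t)
        - l * (partial2 g (?z t) * ?h t + partial3 g (?z t) * ?c t))"
      unfolding V_def integral_mult_right[of _ l0, symmetric] integral_mult_right[of _ l, symmetric]
      by (intro integral_diff[symmetric] integrable_continuous_real continuous_intros sub cp ch cc)
    also have "\<dots> = integral {a..T} (\<lambda>t. P t * ?h t + f t * ?c t)"
      using T by (intro integral_cong) (simp add: P f algebra_simps)
    also have "\<dots> = integral {a..T} (\<lambda>t. P t * ?h t) + integral {a..T} (\<lambda>t. f t * ?c t)"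
      by (intro integral_add integrable_continuous_real continuous_intros sub cP cf ch cc)
    finally show ?thesis
      using integral_mult_comb_RL_int[OF T cf w(1), of \<gamma>] by (simp add: N_def)
  qed
  have EL: "(dual_int \<gamma> \<alpha> \<beta> a T f has_real_derivative - P t) (at t within {a..T})" if t: "t \<in> {a..T}" for t
  proof (cases "a < T")
    case True
    show ?thesis
      by (rule du_Bois_Reymond(1)[OF True T(2) sub[OF cP] dual_int_continuous(1)[OF T cf]
            dual_int_continuous(2)[OF T cf, of \<gamma>, folded N_def] H t])
  next
    \<comment> \<open>Here T = a: the interval is a single point, and any number is a derivative
      within it.\<close>
    case False
    then have "{a..T} = {t}" using t by auto
    then show ?thesis by (simp add: has_field_derivative_def has_derivative_def at_within_def bounded_linear_mult_right)
  qed
  have tail: "(N has_real_derivative 0) (at t within {T..b})" if t: "t \<in> {T..b}" for t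
  proof (cases "T < b")
    case True
    have "N s = 0" if s: "s \<in> {T..b}" for s
    proof (cases "a < T")
      case aT: True
      show ?thesis
        by (rule du_Bois_Reymond(2)[OF aT T(2) sub[OF cP] dual_int_continuous(1)[OF T cf]
              dual_int_continuous(2)[OF T cf, of \<gamma>, folded N_def] H True s])
    next
      \<comment> \<open>For T = a both integrals in \<open>N\<close> have the same base point and
        cancel.\<close>
      case False
      then show ?thesis using T by (simp add: N_def)
    qed
    then show ?thesis
      by (rule_tac has_field_derivative_transform_within[of "\<lambda>_. 0" _ _ _ 1]) (use t in auto)
  next
    case False
    then have "{T..b} = {t}" using t by auto
    then show ?thesis by (simp add: has_field_derivative_def has_derivative_def at_within_def bounded_linear_mult_right)
  qed
  have dual: "P t + dual_deriv \<gamma> \<alpha> \<beta> a b T f t = 0"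
    if "t \<in> {a..T}" "has_RL_deriv_left \<beta> b a f t" "has_RL_deriv_right \<alpha> a T f t" for t
    using dual_deriv_eq[OF ab T(2) EL[OF that(1)] that(2,3)] by simp
  have diff: "snd \<gamma> * (RL_deriv_left \<beta> b a f t - RL_deriv_left \<beta> b T f t) = 0"
    if "t \<in> {T..b}" "has_RL_deriv_left \<beta> b a f t" "has_RL_deriv_left \<beta> b T f t" for t
    using RL_deriv_left_diff_eq[OF T(1) tail[OF that(1), unfolded N_def] that(2,3)] .
  show ?thesis
    using l EL tail dual diff
    unfolding Let_def N_def f_def[abs_def] P_def F_def[abs_def] by blast
qed

end
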